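(* Let $K\subseteq[-1,1]$ be a set having $0$ as a limit point. The functor $\mathfrak{P}$ from C$^\ast$-algebras to pre-C$^\ast$-algebras, $\mathfrak{P}(\mathcal{A})=(\mathcal{A}[Z],\|\cdot\|_K)$, $\mathfrak{P}(f)=\tilde f$, is normal exact; that is, for every short exact sequence of C$^\ast$-algebras $$0\longrightarrow\mathcal{A}\overset{f}{\longrightarrow}\mathcal{B}\overset{g}{\longrightarrow}\mathcal{C}\longrightarrow 0$$ the sequence $$0\longrightarrow\mathcal{A}[Z]\overset{\tilde f}{\longrightarrow}\mathcal{B}[Z]\overset{\tilde g}{\longrightarrow}\mathcal{C}[Z]\longrightarrow 0$$ is a normal exact sequence of pre-C$^\ast$-algebras.
   Context: All C$^\ast$-algebras are complex. For a C$^\ast$-algebra $\mathcal{A}$, $\mathcal{A}[Z]$ is the $\ast$-algebra of all formal power series $F(Z)=\sum_{n=0}^\infty a_nZ^n$ with $a_n\in\mathcal{A}$ and $\sum_{n=0}^\infty\|a_n\|<\infty$, with coefficientwise linear operations, Cauchy product, and involution $(\sum a_nZ^n)^\ast=\sum a_n^\ast Z^n$. For $t\in[-1,1]$, $F(t)=\sum_{n=0}^\infty a_nt^n\in\mathcal{A}$. The norm $\|F\|_K=\sup_{t\in K}\|F(t)\|$ makes $\mathcal{A}[Z]$ a pre-C$^\ast$-algebra (a normed $\ast$-algebra with $\|F^\ast F\|_K=\|F\|_K^2$, not necessarily complete). A $\ast$-homomorphism $f:\mathcal{A}\to\mathcal{B}$ induces $\tilde f:\mathcal{A}[Z]\to\mathcal{B}[Z]$,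 $\tilde f(\sum a_nZ^n)=\sum f(a_n)Z^n$. An exact sequence $\cdots\to A_n\overset{f_n}{\to}A_{n+1}\overset{f_{n+1}}{\to}A_{n+2}\to\cdots$ of normed spaces, with each $f_n$ a linear contraction ($\|f_n\|\le1$), is called normal exact if for every $n$ the induced map $A_n/\ker f_n\to f_n(A_n)$, $x+\ker f_n\mapsto f_n(x)$, is an isometry, where $A_n/\ker f_n$ carries the quotient norm. *)

theory Defs
  imports "HOL-Analysis.Analysis" "HOL-Computational_Algebra.Formal_Power_Series"
begin

section \<open>Complex *-algebras and C*-algebras\<close>

class scaleC =
  fixes scaleC :: "complex \<Rightarrow> 'a \<Rightarrow> 'a" (infixr "*\<^sub>C" 75)

class star =
  fixes star :: "'a \<Rightarrow> 'a"

class complex_star_algebra = ring + scaleC + star +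
  assumes scaleC_add_right: "c *\<^sub>C (x + y) = c *\<^sub>C x + c *\<^sub>C y"
    and scaleC_add_left: "(c + d) *\<^sub>C x = c *\<^sub>C x + d *\<^sub>C x"
    and scaleC_scaleC: "c *\<^sub>C (d *\<^sub>C x) = (c * d) *\<^sub>C x"
    and scaleC_one: "1 *\<^sub>C x = x"
    and mult_scaleC_left: "(c *\<^sub>C x) * y = c *\<^sub>C (x * y)"
    and mult_scaleC_right: "x * (c *\<^sub>C y) = c *\<^sub>C (x * y)"
    and star_add: "star (x + y) = star x + star y"
    and star_scaleC: "star (c *\<^sub>C x) = cnj c *\<^sub>C star x"
    and star_mult: "star (x * y) = star y * star x"
    and star_star: "star (star x) = x"

text \<open>No unit is required, and the zero algebra is allowed.  The real structure inherited from
  \<^class>\<open>real_normed_algebra\<close> is the restriction of the complex one.\<close>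

class cstar_algebra = complex_star_algebra + real_normed_algebra + banach +
  assumes scaleR_scaleC: "scaleR r x = complex_of_real r *\<^sub>C x"
    and norm_scaleC: "norm (c *\<^sub>C x) = cmod c * norm x"
    and norm_star_mult_self: "norm (star x * x) = (norm x)\<^sup>2"

section \<open>Formal power series over a *-algebra\<close>

instantiation fps :: (complex_star_algebra) complex_star_algebra
begin

definition scaleC_fps :: "complex \<Rightarrow> 'a fps \<Rightarrow> 'a fps" where
  "scaleC_fps c F = Abs_fps (\<lambda>n. c *\<^sub>C fps_nth F n)"

definition star_fps :: "'a fps \<Rightarrow> 'a fps" where
  "star_fps F = Abs_fps (\<lambda>n. star (fps_nth F n))"

instance
proof
  fix c d :: complex and F G :: "'a fps"
  have scaleC_sum: "c *\<^sub>C sum h A = (\<Sum>i\<in>A. c *\<^sub>C h i)" if "finite A"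
    for c :: complex and h :: "nat \<Rightarrow> 'a" and A
  proof -
    have "c *\<^sub>C (0::'a) = 0"
      using scaleC_add_right[of c "0::'a" 0] by simp
    with that show ?thesis
      by (induction A rule: finite_induct) (simp_all add: scaleC_add_right)
  qed
  have star_sum: "star (sum h A) = (\<Sum>i\<in>A. star (h i))" if "finite A"
    for h :: "nat \<Rightarrow> 'a" and A
  proof -
    have "star (0::'a) = 0"
      using star_add[of "0::'a" 0] by simp
    with that show ?thesis
      by (induction A rule: finite_induct) (simp_all add: star_add)
  qed
  show "c *\<^sub>C (F + G) = c *\<^sub>C F + c *\<^sub>C G"
    by (simp add: fps_eq_iff scaleC_fps_def scaleC_add_right)
  show "(c + d) *\<^sub>C F = c *\<^sub>C F + d *\<^sub>C F"
    by (simp add: fps_eq_iff scaleC_fps_def scaleC_add_left)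
  show "c *\<^sub>C (d *\<^sub>C F) = (c * d) *\<^sub>C F"
    by (simp add: fps_eq_iff scaleC_fps_def scaleC_scaleC)
  show "1 *\<^sub>C F = F"
    by (simp add: fps_eq_iff scaleC_fps_def scaleC_one)
  show "(c *\<^sub>C F) * G = c *\<^sub>C (F * G)"
    by (simp add: fps_eq_iff scaleC_fps_def fps_mult_nth scaleC_sum mult_scaleC_left)
  show "F * (c *\<^sub>C G) = c *\<^sub>C (F * G)"
    by (simp add: fps_eq_iff scaleC_fps_def fps_mult_nth scaleC_sum mult_scaleC_right)
  show "star (F + G) = star F + star G"
    by (simp add: fps_eq_iff star_fps_def star_add)
  show "star (c *\<^sub>C F) = cnj c *\<^sub>C star F"
    by (simp add: fps_eq_iff star_fps_def scaleC_fps_def star_scaleC)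
  show "star (F * G) = star G * star F"
  proof (rule fps_ext)
    fix n
    have "fps_nth (star (F * G)) n = (\<Sum>i=0..n. star (fps_nth G (n - i)) * star (fps_nth F i))"
      by (simp add: star_fps_def fps_mult_nth star_sum star_mult)
    also have "\<dots> = (\<Sum>i=0..n. star (fps_nth G i) * star (fps_nth F (n - i)))"
      by (subst sum.atLeastAtMost_rev) (rule sum.cong, auto)
    also have "\<dots> = fps_nth (star G * star F) n"
      by (simp add: star_fps_def fps_mult_nth)
    finally show "fps_nth (star (F * G)) n = fps_nth (star G * star F) n" .
  qed
  show "star (star F) = F"
    by (simp add: fps_eq_iff star_fps_def star_star)
qed

end

definition summable_series :: "'a::cstar_algebra fps set" where
  "summable_series = {F. summable (\<lambda>n. norm (fps_nth F n))}"

definition eval_series :: "'a::cstar_algebra fps \<Rightarrow> real \<Rightarrow> 'a" where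
  "eval_series F t = (\<Sum>n. t ^ n *\<^sub>R fps_nth F n)"

definition norm_on :: "real set \<Rightarrow> 'a::cstar_algebra fps \<Rightarrow> real" where
  "norm_on K F = (SUP t\<in>K. norm (eval_series F t))"

definition lift_series :: "('a::cstar_algebra \<Rightarrow> 'b::cstar_algebra) \<Rightarrow> 'a fps \<Rightarrow> 'b fps" where
  "lift_series f F = Abs_fps (\<lambda>n. f (fps_nth F n))"

section \<open>Normed spaces, pre-C*-algebras and their homomorphisms\<close>

text \<open>The norm on formal power series depends on \<open>K\<close>, so normed spaces are
  given by a carrier set together with a norm function; the algebraic operations are those
  of the ambient type.\<close>

definition pre_cstar_algebra :: "'a::complex_star_algebra set \<Rightarrow> ('a \<Rightarrow> real) \<Rightarrow> bool" where
  "pre_cstar_algebra S N \<longleftrightarrow>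
     0 \<in> S \<and>
     (\<forall>x\<in>S. \<forall>y\<in>S. x + y \<in> S \<and> x * y \<in> S) \<and>
     (\<forall>c. \<forall>x\<in>S. c *\<^sub>C x \<in> S) \<and>
     (\<forall>x\<in>S. star x \<in> S) \<and>
     (\<forall>x\<in>S. 0 \<le> N x \<and> (N x = 0 \<longleftrightarrow> x = 0)) \<and>
     (\<forall>x\<in>S. \<forall>y\<in>S. N (x + y) \<le> N x + N y) \<and>
     (\<forall>c. \<forall>x\<in>S. N (c *\<^sub>C x) = cmod c * N x) \<and>
     (\<forall>x\<in>S. \<forall>y\<in>S. N (x * y) \<le> N x * N y) \<and>
     (\<forall>x\<in>S. N (star x * x) = (N x)\<^sup>2)"

definition linear_map_on ::
  "'a::complex_star_algebra set \<Rightarrow> 'b::complex_star_algebra set \<Rightarrow> ('a \<Rightarrow> 'b) \<Rightarrow> bool" where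
  "linear_map_on S T f \<longleftrightarrow>
     (\<forall>x\<in>S. f x \<in> T) \<and>
     (\<forall>x\<in>S. \<forall>y\<in>S. f (x + y) = f x + f y) \<and>
     (\<forall>c. \<forall>x\<in>S. f (c *\<^sub>C x) = c *\<^sub>C f x)"

definition star_hom_on ::
  "'a::complex_star_algebra set \<Rightarrow> 'b::complex_star_algebra set \<Rightarrow> ('a \<Rightarrow> 'b) \<Rightarrow> bool" where
  "star_hom_on S T f \<longleftrightarrow>
     linear_map_on S T f \<and>
     (\<forall>x\<in>S. \<forall>y\<in>S. f (x * y) = f x * f y) \<and>
     (\<forall>x\<in>S. f (star x) = star (f x))"

section \<open>Exact and normal exact sequences\<close>

definition kernel_on :: "'a set \<Rightarrow> ('a \<Rightarrow> 'b::zero) \<Rightarrow> 'a set" where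
  "kernel_on S f = {x\<in>S. f x = 0}"

text \<open>Exactness of \<open>0 \<rightarrow> S \<rightarrow> T \<rightarrow> U \<rightarrow> 0\<close>, where the zero object is the subset
  \<open>{0}\<close> of the type of its neighbour.\<close>

definition short_exact_on ::
  "'a::zero set \<Rightarrow> 'b::zero set \<Rightarrow> 'c::zero set \<Rightarrow> ('a \<Rightarrow> 'b) \<Rightarrow> ('b \<Rightarrow> 'c) \<Rightarrow> bool" where
  "short_exact_on S T U f g \<longleftrightarrow>
     (\<lambda>_. 0) ` {0::'a} = kernel_on S f \<and>
     f ` S = kernel_on T g \<and>
     g ` T = kernel_on U (\<lambda>_. 0::'c)"

definition short_exact_cstar ::
  "('a::cstar_algebra \<Rightarrow> 'b::cstar_algebra) \<Rightarrow> ('b \<Rightarrow> 'c::cstar_algebra) \<Rightarrow> bool" where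
  "short_exact_cstar f g \<longleftrightarrow>
     star_hom_on UNIV UNIV f \<and> star_hom_on UNIV UNIV g \<and> short_exact_on UNIV UNIV UNIV f g"

definition coset :: "'a::plus set \<Rightarrow> 'a \<Rightarrow> 'a set" where
  "coset M x = (\<lambda>m. x + m) ` M"

definition quotient_norm :: "('a \<Rightarrow> real) \<Rightarrow> 'a set \<Rightarrow> real" where
  "quotient_norm N C = (INF z\<in>C. N z)"

definition linear_contraction_on ::
  "'a::complex_star_algebra set \<Rightarrow> ('a \<Rightarrow> real) \<Rightarrow>
   'b::complex_star_algebra set \<Rightarrow> ('b \<Rightarrow> real) \<Rightarrow> ('a \<Rightarrow> 'b) \<Rightarrow> bool" where
  "linear_contraction_on S N T M f \<longleftrightarrow>
     linear_map_on S T f \<and> (\<forall>x\<in>S. M (f x) \<le> N x)"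

text \<open>The induced map on \<open>S / ker f\<close> is linear, so it is an isometry iff it preserves norms.\<close>

definition normal_map_on ::
  "'a::complex_star_algebra set \<Rightarrow> ('a \<Rightarrow> real) \<Rightarrow> ('b::complex_star_algebra \<Rightarrow> real) \<Rightarrow>
   ('a \<Rightarrow> 'b) \<Rightarrow> bool" where
  "normal_map_on S N M f \<longleftrightarrow>
     (\<forall>x\<in>S. M (f x) = quotient_norm N (coset (kernel_on S f) x))"

definition normal_short_exact_on ::
  "'a::complex_star_algebra set \<Rightarrow> ('a \<Rightarrow> real) \<Rightarrow>
   'b::complex_star_algebra set \<Rightarrow> ('b \<Rightarrow> real) \<Rightarrow>
   'c::complex_star_algebra set \<Rightarrow> ('c \<Rightarrow> real) \<Rightarrow>
   ('a \<Rightarrow> 'b) \<Rightarrow> ('b \<Rightarrow> 'c) \<Rightarrow> bool" where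
  "normal_short_exact_on S N\<^sub>S T N\<^sub>T U N\<^sub>U f g \<longleftrightarrow>
     short_exact_on S T U f g \<and>
     linear_contraction_on {0} N\<^sub>S S N\<^sub>S (\<lambda>_. 0) \<and> normal_map_on {0} N\<^sub>S N\<^sub>S (\<lambda>_. 0) \<and>
     linear_contraction_on S N\<^sub>S T N\<^sub>T f \<and> normal_map_on S N\<^sub>S N\<^sub>T f \<and>
     linear_contraction_on T N\<^sub>T U N\<^sub>U g \<and> normal_map_on T N\<^sub>T N\<^sub>U g \<and>
     linear_contraction_on U N\<^sub>U {0} N\<^sub>U (\<lambda>_. 0) \<and> normal_map_on U N\<^sub>U N\<^sub>U (\<lambda>_. 0)"

end

theory Submission
  imports Defs
begin

text \<open>
  The analytic core is that a *-homomorphism \<open>g\<close> is contractive, is isometric when injective, and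
  that finitely many (hence compactly many) elements \<open>b\<close> admit a common \<open>u\<close> in the kernel with
  \<open>1 - u\<close> contractive and \<open>norm (b - b u) \<le> norm (g b) + \<epsilon>\<close>.  Given this, a series \<open>F\<close> is moved
  within its coset to \<open>F - F u\<close>, where \<open>u\<close> serves the compact set \<open>F ` [-1, 1]\<close>, and
  coefficients are lifted along a surjection with almost the same norm.

  The core needs no spectral theory.  Square roots of \<open>1 - p\<close> come from an iteration, and
  commuting self-adjoint \<open>c\<close>, \<open>d\<close> with \<open>c\<^sup>2 + d\<^sup>2 = 1\<close> are contractive because \<open>c \<plusminus> \<i>d\<close> are unitary.
  A homomorphism preserves such a pair, which gives contractivity.  For the remaining parts take
  \<open>s = 1 - \<bar>1 - 2k\<^sup>2\<bar>\<close>: if \<open>2 (norm (g k))\<^sup>2 < 1\<close> then \<open>g s = 2 (g k)\<^sup>2\<close>, so \<open>k\<^sup>2 - s/2\<close> lies in the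
  kernel.  When the kernel is trivial this bounds \<open>norm k\<close>; otherwise it is the required \<open>u\<close>, up to
  rescaling and composing several such cutoffs.

  There is no unit, so \<open>1 - m\<close> stands for the operator \<open>x \<mapsto> x - x m\<close>.
\<close>

section \<open>Square roots and rotations\<close>

lemma scaleC_0_right [simp]: "c *\<^sub>C (0::'a::complex_star_algebra) = 0"
  using scaleC_add_right[of c "0::'a" 0] by simp

lemma scaleC_minus_left: "(- c) *\<^sub>C x = - (c *\<^sub>C (x::'a::complex_star_algebra))"
proof -
  have "0 *\<^sub>C x = 0" using scaleC_add_left[of 0 0 x] by simp
  then show ?thesis using scaleC_add_left[of "-c" c x] by (simp add: eq_neg_iff_add_eq_0)
qed

lemma scaleC_diff_right: "c *\<^sub>C (x - y) = c *\<^sub>C x - c *\<^sub>C (y::'a::complex_star_algebra)"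
  using scaleC_add_right[of c "x - y" y] by simp

lemma star_0 [simp]: "star (0::'a::complex_star_algebra) = 0"
  using star_add[of "0::'a" 0] by simp

lemma star_minus: "star (- x) = - star (x::'a::complex_star_algebra)"
  using star_add[of x "-x"] by (simp add: eq_neg_iff_add_eq_0 add.commute)

lemma star_diff: "star (x - y) = star x - star (y::'a::complex_star_algebra)"
  using star_add[of x "-y"] by (simp add: star_minus)

lemma star_scaleR: "star (r *\<^sub>R x) = r *\<^sub>R star (x::'a::cstar_algebra)"
  by (simp add: scaleR_scaleC star_scaleC)

lemma norm_star: "norm (star x) = norm (x::'a::cstar_algebra)"
proof -
  have *: "norm y \<le> norm (star y)" for y :: 'a
  proof (cases "y = 0")
    case False
    have "norm y * norm y \<le> norm (star y) * norm y"
      using norm_star_mult_self[of y] norm_mult_ineq[of "star y" y] by (simp add: power2_eq_square)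
    with False show ?thesis by simp
  qed simp
  show ?thesis using *[of x] *[of "star x"] by (simp add: star_star)
qed

lemma norm_mult_star_self: "norm (x * star x) = (norm (x::'a::cstar_algebra))\<^sup>2"
  using norm_star_mult_self[of "star x"] by (simp add: star_star norm_star)

lemma bounded_linear_star: "bounded_linear (star :: 'a::cstar_algebra \<Rightarrow> 'a)"
  by (rule bounded_linear_intro[where K = 1]) (auto simp: star_add star_scaleR norm_star)

lemma bounded_linear_scaleC: "bounded_linear (\<lambda>x::'a::cstar_algebra. c *\<^sub>C x)"
  by (rule bounded_linear_intro[where K = "cmod c"])
    (auto simp: scaleC_add_right norm_scaleC scaleR_scaleC scaleC_scaleC mult.commute)

lemma norm_self_adjoint_square:
  fixes k :: "'a::cstar_algebra"
  assumes "star k = k"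
  shows "norm (k * k) = (norm k)\<^sup>2"
  using norm_star_mult_self[of k] assms by simp

text \<open>The C*-identity turns the second hypothesis into \<open>(norm k)^2 \<le> norm k\<close>.
  With no unit to evaluate at, a bound on the operator \<open>x \<mapsto> x * k\<close> is read off
  at \<open>x = k\<close>.\<close>

lemma norm_le_1_if_contractive:
  fixes k :: "'a::cstar_algebra"
  assumes "star k = k" "norm (k * k) \<le> norm k"
  shows "norm k \<le> 1"
  using assms norm_self_adjoint_square[of k]
  by (cases "k = 0") (auto simp: power2_eq_square)

text \<open>Self-adjointness for the algebra-valued inner product \<open>x * star y\<close>. It also
  covers \<open>x \<mapsto> x - x * m\<close>, which need not be multiplication by an element of the
  algebra.\<close>

definition self_adjoint_op :: "('a::cstar_algebra \<Rightarrow> 'a) \<Rightarrow> bool" where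
  "self_adjoint_op H \<longleftrightarrow> (\<forall>x y. H x * star y = x * star (H y))"

lemma norm_self_adjoint_op:
  assumes "self_adjoint_op H"
  shows "(norm (H x))\<^sup>2 = norm (x * star (H (H x)))"
  using assms norm_mult_star_self[of "H x"] by (simp add: self_adjoint_op_def)

text \<open>\<open>C \<plusminus> \<i>D\<close> act as unitaries, and \<open>C\<close>, \<open>D\<close> are their real and imaginary parts.\<close>

lemma rotation_contractive:
  fixes C D :: "'a::cstar_algebra \<Rightarrow> 'a"
  assumes C: "self_adjoint_op C" and D: "self_adjoint_op D"
    and comm: "C (D x) = D (C x)" and unit: "C (C x) + D (D x) = x"
  shows "norm (C x) \<le> norm x" "norm (D x) \<le> norm x"
proof -
  \<comment> \<open>The conditions say \<open>c = \<i>\<close> or \<open>c = - \<i>\<close>. The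
    cross terms cancel, as both products equal \<open>x * star (D (C x))\<close>.\<close>
  have *: "norm (C x + c *\<^sub>C D x) = norm x" if c: "cnj c = - c" "c * cnj c = 1" for c
  proof -
    have cc: "c * c = - 1" using c by (metis minus_mult_right minus_minus)
    have a: "C x * star (D x) = x * star (D (C x))" "D x * star (C x) = x * star (D (C x))"
      "C x * star (C x) = x * star (C (C x))" "D x * star (D x) = x * star (D (D x))"
      using C D comm unfolding self_adjoint_op_def by auto
    have "(C x + c *\<^sub>C D x) * star (C x + c *\<^sub>C D x) =
      C x * star (C x) + D x * star (D x) + (c *\<^sub>C (D x * star (C x)) - c *\<^sub>C (C x * star (D x)))"
      by (simp add: star_add star_scaleC c scaleC_add_right cc scaleC_minus_left scaleC_diff_right distrib_left distrib_right
          right_diff_distrib mult_scaleC_left mult_scaleC_right scaleC_scaleC scaleC_one)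
    also have "\<dots> = x * star x"
      using unit by (simp add: a flip: distrib_left star_add)
    finally show ?thesis
      using norm_mult_star_self[of "C x + c *\<^sub>C D x"] norm_mult_star_self[of x]
      by (simp add: power2_eq_iff_nonneg)
  qed
  let ?p = "C x + \<i> *\<^sub>C D x" and ?m = "C x + (-\<i>) *\<^sub>C D x"
  have p: "norm ?p = norm x" and m: "norm ?m = norm x" using * by simp_all
  have "?p + ?m = 2 *\<^sub>R C x" by (simp add: scaleR_2 scaleC_minus_left)
  then have "2 * norm (C x) \<le> 2 * norm x"
    using norm_triangle_ineq[of ?p ?m] p m by simp
  then show "norm (C x) \<le> norm x" by simp
  have "?p - ?m = 2 *\<^sub>R (\<i> *\<^sub>C D x)" by (simp add: scaleR_2 scaleC_minus_left)
  then have "2 * norm (D x) \<le> 2 * norm x"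
    using norm_triangle_ineq4[of ?p ?m] p m by (simp add: norm_scaleC)
  then show "norm (D x) \<le> norm x" by simp
qed

lemma self_adjoint_op_mult:
  assumes "star m = m"
  shows "self_adjoint_op (\<lambda>x. x * m)" "self_adjoint_op (\<lambda>x. x - x * m)"
  using assms by (auto simp: self_adjoint_op_def star_mult star_diff algebra_simps)

text \<open>The sine is \<open>k\<close> and the cosine \<open>1 - s\<close>: the last hypothesis is
  \<open>(1 - s)^2 + k^2 = 1\<close> with the unit cancelled.\<close>

lemma rotation_mult_contractive:
  fixes k s :: "'a::cstar_algebra"
  assumes "star k = k" "star s = s" "s * k = k * s" "s * s + k * k = s + s"
  shows "norm (x * k) \<le> norm x" "norm (x - x * s) \<le> norm x" "norm k \<le> 1"
proof -
  have 1: "x * s * k = x * k * s" for x using assms(3) by (simp add: mult.assoc)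
  have "x * (s * s) + x * (k * k) = x * s + x * s" for x using assms(4) by (metis distrib_left)
  then have 2: "x * s * s + x * k * k = x * s + x * s" for x by (simp add: mult.assoc)
  have *: "norm (x * k) \<le> norm x \<and> norm (x - x * s) \<le> norm x" for x
    using rotation_contractive[of "\<lambda>x. x - x * s" "\<lambda>x. x * k" x] assms(1,2) 1[of x] 2[of x]
    by (simp add: self_adjoint_op_mult algebra_simps)
  then show "norm (x * k) \<le> norm x" "norm (x - x * s) \<le> norm x" by auto
  show "norm k \<le> 1" using * assms(1) by (intro norm_le_1_if_contractive) auto
qed

text \<open>\<open>1 - s\<close> is the positive square root of \<open>1 - p\<close>, obtained by iterating
  \<open>s \<mapsto> (p + s\<^sup>2) / 2\<close>; the scalar iteration for \<open>p = 1\<close> dominates, also in the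
  critical case \<open>norm p = 1\<close>.\<close>

fun sqrt_iter :: "'a::real_normed_algebra \<Rightarrow> nat \<Rightarrow> 'a" where
  "sqrt_iter p 0 = 0"
| "sqrt_iter p (Suc n) = (1/2) *\<^sub>R (p + sqrt_iter p n * sqrt_iter p n)"

lemma sqrt_iter_1_bounds:
  fixes n
  defines "t \<equiv> sqrt_iter (1::real)"
  shows "0 \<le> t n \<and> t n \<le> 1"
proof (induction n)
  case (Suc n)
  then show ?case using mult_mono[of "t n" 1 "t n" 1] by (simp add: t_def field_simps)
qed (simp add: t_def)

text \<open>Successive iterates \<open>a\<close>, \<open>b\<close>, \<open>c\<close> satisfy
  \<open>2 (c - b) = b (b - a) + (b - a) a\<close>. The scalars \<open>t\<close> satisfy the same
  identity, so the bounds on iterates and increments propagate together.\<close>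

lemma sqrt_iter_dominated:
  fixes p :: "'a::cstar_algebra"
  assumes "norm p \<le> 1"
  defines "t \<equiv> sqrt_iter (1::real)"
  shows "norm (sqrt_iter p n) \<le> t n \<and> norm (sqrt_iter p (Suc n) - sqrt_iter p n) \<le> t (Suc n) - t n"
proof (induction n)
  case 0
  then show ?case using assms by simp
next
  case (Suc n)
  let ?a = "sqrt_iter p n" and ?b = "sqrt_iter p (Suc n)"
  have a: "norm ?a \<le> t n" and d: "norm (?b - ?a) \<le> t (Suc n) - t n" using Suc by auto
  have b: "norm ?b \<le> t (Suc n)" using norm_triangle_ineq[of "?b - ?a" ?a] a d by simp
  have "sqrt_iter p (Suc (Suc n)) - ?b = (1/2) *\<^sub>R (p + ?b * ?b) - (1/2) *\<^sub>R (p + ?a * ?a)"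
    by (simp del: sqrt_iter.simps add: sqrt_iter.simps(2)[of p])
  also have "\<dots> = (1/2) *\<^sub>R (?b * (?b - ?a) + (?b - ?a) * ?a)"
    by (simp del: sqrt_iter.simps add: algebra_simps)
  finally have "norm (sqrt_iter p (Suc (Suc n)) - ?b) = norm (?b * (?b - ?a) + (?b - ?a) * ?a) / 2"
    by (simp del: sqrt_iter.simps)
  also have "\<dots> \<le> (norm ?b * norm (?b - ?a) + norm (?b - ?a) * norm ?a) / 2"
    by (intro divide_right_mono order.trans[OF norm_triangle_ineq] add_mono norm_mult_ineq) auto
  also have "\<dots> \<le> (t (Suc n) * (t (Suc n) - t n) + (t (Suc n) - t n) * t n) / 2"
    using a b d sqrt_iter_1_bounds[of "Suc n"] order.trans[OF norm_ge_zero d]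
    by (intro divide_right_mono add_mono mult_mono) (auto simp: t_def simp del: sqrt_iter.simps)
  also have "\<dots> = t (Suc (Suc n)) - t (Suc n)"
  proof -
    have "t (Suc m) = (1 + t m * t m) / 2" for m by (simp add: t_def)
    from this[of "Suc n"] this[of n] show ?thesis by (simp only:) (simp add: field_simps)
  qed
  finally show ?case using b by simp
qed

text \<open>The increments are dominated by those of a bounded increasing real sequence, so the
  iteration converges. The fixed point equation \<open>2 s = p + s^2\<close> says
  \<open>(1 - s)^2 = 1 - p\<close>.\<close>

lemma sqrt_one_minus_exists:
  fixes p :: "'a::cstar_algebra"
  assumes p: "star p = p" "norm p \<le> 1"
  obtains s where "star s = s" "norm s \<le> 1" "s * s + p = s + s"
    "\<And>y. y * p = p * y \<Longrightarrow> y * s = s * y"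
proof -
  define t where "t = sqrt_iter (1::real)"
  let ?s = "sqrt_iter p"
  have dom: "norm (?s n) \<le> t n" "norm (?s (Suc n) - ?s n) \<le> t (Suc n) - t n" for n
    using sqrt_iter_dominated[OF p(2), of n] unfolding t_def by auto
  have inc: "t n \<le> t (Suc n)" for n using order.trans[OF norm_ge_zero dom(2)[of n]] by simp
  have tb: "0 \<le> t n" "t n \<le> 1" for n using sqrt_iter_1_bounds unfolding t_def by auto
  have "monoseq t" using inc by (simp add: monoseq_Suc)
  moreover have "Bseq t" using tb by (intro BseqI'[where K = 1]) (simp add: abs_le_iff)
  ultimately have "Cauchy t" using Bseq_monoseq_convergent convergent_Cauchy by blast
  then have "summable (\<lambda>n. t (Suc n) - t n)"
    using telescope_summable Cauchy_convergent convergent_LIMSEQ_iff by blast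
  then have "summable (\<lambda>n. ?s (Suc n) - ?s n)"
    by (rule summable_comparison_test'[where N = 0]) (use dom in auto)
  then have "convergent (\<lambda>n. \<Sum>i<n. ?s (Suc i) - ?s i)" by (simp add: summable_iff_convergent)
  then have "convergent ?s" unfolding sum_lessThan_telescope by simp
  then obtain s where s: "?s \<longlonglongrightarrow> s" by (auto simp: convergent_def)
  have starn: "star (?s n) = ?s n" for n
    by (induction n) (auto simp: star_scaleR star_add star_mult p)
  have commn: "y * ?s n = ?s n * y" if "y * p = p * y" for y n
  proof (induction n)
    case (Suc n)
    then have "y * (?s n * ?s n) = (?s n * ?s n) * y" by (metis mult.assoc)
    with that show ?case by (simp add: algebra_simps)
  qed simp
  show thesis
  proof
    have "(\<lambda>n. star (?s n)) \<longlonglongrightarrow> star s" using bounded_linear.tendsto[OF bounded_linear_star s] .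
    then show "star s = s" using s LIMSEQ_unique by (simp add: starn)
    have "(\<lambda>n. norm (?s n)) \<longlonglongrightarrow> norm s" using s by (rule tendsto_norm)
    then show "norm s \<le> 1"
      by (rule LIMSEQ_le_const2) (use dom tb order.trans in blast)
    have "(\<lambda>n. (1/2) *\<^sub>R (p + ?s n * ?s n)) \<longlonglongrightarrow> (1/2) *\<^sub>R (p + s * s)"
      by (intro tendsto_intros s)
    moreover have "(\<lambda>n. (1/2) *\<^sub>R (p + ?s n * ?s n)) \<longlonglongrightarrow> s"
      using LIMSEQ_Suc[OF s] by simp
    ultimately have "s = (1/2) *\<^sub>R (p + s * s)" using LIMSEQ_unique by blast
    then have "2 *\<^sub>R s = p + s * s" by (metis scaleR_half_double scaleR_scaleR scaleR_2 scaleR_add_right)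
    then show "s * s + p = s + s" by (simp add: scaleR_2 add.commute)
    show "y * s = s * y" if "y * p = p * y" for y
      using tendsto_mult[OF tendsto_const s, of y] tendsto_mult[OF s tendsto_const, of y]
        LIMSEQ_unique by (simp add: commn[OF that])
  qed
qed

text \<open>\<open>d\<close> and \<open>1 - 2k\<^sup>2\<close> are the sine and cosine of twice the angle whose sine is \<open>k\<close>.\<close>

lemma double_angle:
  fixes k :: "'a::cstar_algebra"
  assumes "star k = k" "norm k \<le> 1"
  defines "p \<equiv> 4 *\<^sub>R (k * k) - 4 *\<^sub>R (k * k * (k * k))"
  obtains d where "star d = d" "d * d = p" "norm d \<le> 1"
    "\<And>x. norm (x - 2 *\<^sub>R (x * (k * k))) \<le> norm x"
proof -
  have kk: "star (k * k) = k * k" "norm (k * k) \<le> 1"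
    using assms norm_self_adjoint_square[of k] by (auto simp: star_mult power_le_one)
  obtain s where s: "star s = s" "norm s \<le> 1" "s * s + k * k = s + s"
    "\<And>y. y * (k * k) = k * k * y \<Longrightarrow> y * s = s * y"
    using sqrt_one_minus_exists[OF kk] by blast
  have ks: "k * s = s * k" by (rule s(4)) (simp add: mult.assoc)
  then have ks': "s * (k * x) = k * (s * x)" for x by (metis mult.assoc)
  have ss: "s * s = s + s - k * k" using s(3) by (simp add: algebra_simps)
  have kss: "k * (k * (s * s)) = k * (k * s) + k * (k * s) - k * (k * (k * k))"
    unfolding ss by (simp add: distrib_left right_diff_distrib)
  \<comment> \<open>Since \<open>1 - s\<close> is the cosine belonging to the sine \<open>k\<close>,
    this is twice sine times cosine.\<close>
  let ?d = "2 *\<^sub>R (k - k * s)"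
  have d: "star ?d = ?d" using assms(1) s(1) ks by (simp add: star_scaleR star_diff star_mult)
  have "?d * ?d = 4 *\<^sub>R ((k - k * s) * (k - k * s))" by simp
  also have "(k - k * s) * (k - k * s) = k * (k - k * s) - k * (s * k) + k * (s * (k * s))"
    by (simp add: algebra_simps)
  also have "\<dots> = k * k - k * k * (k * k)"
    unfolding ks' by (simp add: right_diff_distrib mult.assoc kss flip: ks)
  finally have dd: "?d * ?d = p" by (simp add: p_def scaleR_diff_right)
  have dk: "?d * k = k * ?d" by (simp add: left_diff_distrib right_diff_distrib mult.assoc flip: ks)
  let ?t = "2 *\<^sub>R (k * k)"
  have kkd: "k * k * ?d = ?d * (k * k)" using dk by (metis mult.assoc)
  have td: "?t * ?d = ?d * ?t" unfolding mult_scaleR_left mult_scaleR_right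
    using kkd unfolding mult_scaleR_left mult_scaleR_right by simp
  \<comment> \<open>This is \<open>(1 - ?t)^2 + ?d^2 = 1\<close>.\<close>
  have "?t * ?t + ?d * ?d = ?t + ?t"
    unfolding dd p_def by (simp flip: scaleR_2)
  note rot = rotation_mult_contractive[OF d _ td this]
  show thesis
    by (rule that[of ?d, OF d dd]) (use rot kk in \<open>auto simp: star_scaleR\<close>)
qed

text \<open>With \<open>v = 1 - 2k\<^sup>2\<close>, the element \<open>s\<close> below is \<open>1 - \<bar>v\<bar>\<close>.\<close>

lemma abs_exists:
  fixes k :: "'a::cstar_algebra"
  assumes k: "star k = k" "norm k \<le> 1"
  obtains s where "star s = s" "norm s \<le> 1"
    "s * s + (4 *\<^sub>R (k * k) - 4 *\<^sub>R (k * k * (k * k))) = s + s" "s * k = k * s"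
    "\<And>x. norm (x - x * s) \<le> norm x" "\<And>x. norm (x - 2 *\<^sub>R (x * (k * k))) \<le> norm x"
proof -
  \<comment> \<open>This is \<open>1 - v^2\<close>, so the square root of \<open>1 - ?p\<close> is
    the absolute value of \<open>v\<close>.\<close>
  let ?p = "4 *\<^sub>R (k * k) - 4 *\<^sub>R (k * k * (k * k))"
  obtain d where d: "star d = d" "d * d = ?p" "norm d \<le> 1"
    "\<And>x. norm (x - 2 *\<^sub>R (x * (k * k))) \<le> norm x"
    using double_angle[OF k] by metis
  have p: "star ?p = ?p" "norm ?p \<le> 1"
    using d(1,3) norm_self_adjoint_square[of d] unfolding d(2)[symmetric]
    by (auto simp: star_mult power_le_one)
  obtain s where s: "star s = s" "norm s \<le> 1" "s * s + ?p = s + s"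
    and comm: "\<And>y. y * ?p = ?p * y \<Longrightarrow> y * s = s * y"
    using sqrt_one_minus_exists[OF p] by blast
  have sd: "s * d = d * s" by (rule comm[symmetric]) (metis d(2) mult.assoc)
  have "k * s = s * k" by (rule comm) (simp add: algebra_simps)
  \<comment> \<open>The cosine \<open>1 - s\<close> now has sine \<open>d\<close>, because
    \<open>s^2 + d^2 = s + s\<close>.\<close>
  moreover have "norm (x - x * s) \<le> norm x" for x
    by (rule rotation_mult_contractive(2)[OF d(1) s(1) sd]) (simp add: s d)
  ultimately show thesis using that s d by metis
qed

text \<open>Self-adjointness gives \<open>(norm (H^n x))^2 \<le> norm x * norm (H^(2n) x)\<close>.
  By repeated doubling, a ratio \<open>q = norm (H x) / norm x\<close> above 1 would make the powers
  grow at least like \<open>q^(2^m)\<close>.\<close>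

lemma power_bounded_contractive:
  assumes H: "self_adjoint_op H" and bdd: "\<And>n. norm ((H ^^ n) x) \<le> C * norm x"
  shows "norm (H x) \<le> norm x"
proof (rule ccontr)
  assume less: "\<not> norm (H x) \<le> norm x"
  have x: "norm x > 0"
  proof (rule ccontr)
    assume "\<not> norm x > 0"
    then show False using bdd[of 1] less by simp
  qed
  define q where "q = norm (H x) / norm x"
  have "self_adjoint_op (H ^^ n)" for n
  proof (induction n)
    case (Suc n)
    then show ?case using H unfolding self_adjoint_op_def by (simp add: funpow_swap1)
  qed (simp add: self_adjoint_op_def)
  then have sq: "(norm ((H ^^ n) x))\<^sup>2 \<le> norm x * norm ((H ^^ (n + n)) x)" for n
    using norm_mult_ineq[of x "star ((H ^^ n) ((H ^^ n) x))"]
    by (simp add: norm_self_adjoint_op norm_star funpow_add)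
  have "q ^ (2 ^ m) * norm x \<le> norm ((H ^^ (2 ^ m)) x)" for m
  proof (induction m)
    case 0
    then show ?case using x by (simp add: q_def)
  next
    case (Suc m)
    have "(q ^ (2 ^ m) * norm x)\<^sup>2 \<le> norm x * norm ((H ^^ (2 ^ m + 2 ^ m)) x)"
      using order.trans[OF power_mono[OF Suc, of 2] sq[of "2 ^ m"]] x by (simp add: q_def)
    then have "norm x * (q ^ (2 ^ Suc m) * norm x) \<le> norm x * norm ((H ^^ (2 ^ m + 2 ^ m)) x)"
      by (simp add: power2_eq_square power_add mult_2 mult_ac)
    then show ?case using x by (simp add: mult_2)
  qed
  then have "q ^ (2 ^ m) * norm x \<le> C * norm x" for m using bdd order.trans by blast
  then have bound: "q ^ (2 ^ m) \<le> C" for m using x by simp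
  have q: "q > 1" using less x by (simp add: q_def)
  then obtain n where "C < q ^ n" using real_arch_pow by blast
  also have "q ^ n \<le> q ^ (2 ^ n)"
    using q by (intro power_increasing) (auto intro: less_imp_le less_exp)
  finally show False using bound[of n] by simp
qed

section \<open>Negative parts\<close>

text \<open>For \<open>V\<^sup>2 = W\<^sup>2\<close> and \<open>W \<ge> 0\<close>, the operator below is \<open>1\<close> minus the negative part of \<open>V\<close>.
  Since \<open>V\<close> and \<open>W\<close> give the same norms, its powers are bounded by a
  telescoping sum.\<close>

lemma one_minus_negative_part_contractive:
  fixes V W :: "'a::cstar_algebra \<Rightarrow> 'a"
  assumes V: "self_adjoint_op V" "linear V" and W: "self_adjoint_op W" "linear W"
    and sq: "\<And>x. V (V x) = W (W x)" and comm: "\<And>x. V (W x) = W (V x)"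
    and s: "\<And>x. norm (x - W x) \<le> norm x"
  shows "norm (x - (1/2) *\<^sub>R (W x - V x)) \<le> norm x"
proof -
  \<comment> \<open>\<open>Q n\<close> is a partial Neumann sum for the inverse of
    \<open>W = 1 - S\<close>; hence \<open>W (Q n)\<close> telescopes.\<close>
  define E where "E = (\<lambda>x. x - (1/2) *\<^sub>R (W x - V x))"
  define S where "S = (\<lambda>x. x - W x)"
  define Q where "Q = (\<lambda>n. \<Sum>i<n. (S ^^ i) x)"
  note lin = linear_add[OF V(2)] linear_add[OF W(2)] linear_diff[OF V(2)] linear_diff[OF W(2)]
    linear_scale[OF V(2)] linear_scale[OF W(2)] linear_0[OF V(2)] linear_0[OF W(2)]
  have "self_adjoint_op E"
    using V(1) W(1) unfolding self_adjoint_op_def E_def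
    by (simp add: left_diff_distrib right_diff_distrib star_diff star_scaleR)
  moreover have "norm ((E ^^ n) x) \<le> 2 * norm x" for n
  proof -
    have WQ: "W (Q n) = x - (S ^^ n) x" for n
      by (induction n) (simp_all add: Q_def lin S_def)
    \<comment> \<open>Heuristically \<open>E\<close> is 1 where \<open>V\<close> is positive and
      \<open>S\<close> where it is negative, so \<open>2 E^n = 1 + S^n + sgn V (1 - S^n)\<close>.
      The term \<open>V (Q n)\<close> expresses the last summand without a sign function.\<close>
    have E: "2 *\<^sub>R (E ^^ n) x = x + (S ^^ n) x + V (Q n)" for n
    proof (induction n)
      case 0
      then show ?case by (simp add: Q_def lin scaleR_2)
    next
      case (Suc n)
      let ?e = "(E ^^ n) x" and ?a = "(S ^^ n) x"
      have "4 *\<^sub>R (E ^^ Suc n) x = 2 *\<^sub>R (2 *\<^sub>R ?e) - W (2 *\<^sub>R ?e) + V (2 *\<^sub>R ?e)"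
        by (simp add: E_def lin scaleR_diff_right)
      also have "\<dots> = 2 *\<^sub>R (x + ?a + V (Q n)) - W (x + ?a + V (Q n)) + V (x + ?a + V (Q n))"
        unfolding Suc ..
      also have "\<dots> = 2 *\<^sub>R (x + ?a + V (Q n)) - W x - W ?a - V (W (Q n)) + V x + V ?a + W (W (Q n))"
        by (simp add: lin sq comm)
      also have "\<dots> = 2 *\<^sub>R (x + (?a - W ?a) + (V (Q n) + V ?a))"
        unfolding WQ by (simp add: lin scaleR_2)
      also have "\<dots> = 2 *\<^sub>R (x + (S ^^ Suc n) x + V (Q (Suc n)))"
        by (simp add: S_def Q_def lin)
      finally have "2 *\<^sub>R (2 *\<^sub>R (E ^^ Suc n) x) = 2 *\<^sub>R (x + (S ^^ Suc n) x + V (Q (Suc n)))"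
        by simp
      then show ?case by (metis scaleR_cancel_left zero_neq_numeral)
    qed
    have a: "norm ((S ^^ n) x) \<le> norm x"
      by (induction n) (auto intro: order.trans[OF s] simp: S_def)
    have "(norm (V (Q n)))\<^sup>2 = (norm (W (Q n)))\<^sup>2"
      using V(1) W(1) by (simp add: norm_self_adjoint_op sq)
    then have "norm (V (Q n)) = norm (x - (S ^^ n) x)" unfolding WQ by simp
    also have "\<dots> \<le> norm x + norm ((S ^^ n) x)" by (rule norm_triangle_ineq4)
    finally have "norm (2 *\<^sub>R (E ^^ n) x) \<le> 4 * norm x"
      using a norm_triangle_ineq[of "x + (S ^^ n) x" "V (Q n)"] norm_triangle_ineq[of x "(S ^^ n) x"]
      unfolding E by simp
    then show ?thesis by simp
  qed
  ultimately have "norm (E x) \<le> norm x" by (rule power_bounded_contractive)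
  then show ?thesis by (simp add: E_def)
qed

text \<open>With \<open>v = 1 - 2k\<^sup>2\<close>, \<open>s = 1 - \<bar>v\<bar>\<close>, the element \<open>u = k\<^sup>2 - s/2\<close> is the negative part of \<open>v\<close>
  and \<open>b = k\<^sup>2 + s/2\<close> is \<open>1\<close> minus its positive part; hence \<open>2k\<^sup>2(1 - u) = b(1 - u\<^sup>2)\<close>.\<close>

lemma cutoff:
  fixes k s :: "'a::cstar_algebra"
  assumes k: "star k = k" and s: "star s = s" "norm s \<le> 1" "s * k = k * s"
    and sp: "s * s + (4 *\<^sub>R (k * k) - 4 *\<^sub>R (k * k * (k * k))) = s + s"
    and cs: "\<And>x. norm (x - x * s) \<le> norm x" and ck: "\<And>x. norm (x - 2 *\<^sub>R (x * (k * k))) \<le> norm x"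
  defines "u \<equiv> k * k - (1/2) *\<^sub>R s"
  shows "star u = u" "norm (x - x * u) \<le> norm x" "(norm (k - k * u))\<^sup>2 \<le> 1/2"
proof -
  define V where "V = (\<lambda>x. x - 2 *\<^sub>R (x * (k * k)))"
  define W where "W = (\<lambda>x. x - x * s)"
  define b where "b = k * k + (1/2) *\<^sub>R s"
  show u: "star u = u" using k s by (simp add: u_def star_diff star_mult star_scaleR)
  have b: "star b = b" using k s by (simp add: b_def star_add star_mult star_scaleR)
  have skk: "s * (k * k) = k * k * s" using s(3) by (metis mult.assoc)
  have ss: "s * s = s + s - 4 *\<^sub>R (k * k) + 4 *\<^sub>R (k * k * (k * k))"
    using sp by (simp add: algebra_simps)
  have V: "self_adjoint_op V" "linear V"
    using k unfolding self_adjoint_op_def V_def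
    by (auto simp: left_diff_distrib right_diff_distrib star_diff star_scaleR star_mult mult.assoc
        distrib_right scaleR_add_right scaleR_diff_right intro!: linearI)
  have W: "self_adjoint_op W" "linear W"
    using self_adjoint_op_mult[OF s(1)] unfolding W_def
    by (auto simp: distrib_right scaleR_diff_right intro!: linearI)
  \<comment> \<open>The negative part of \<open>- V\<close> is the positive part of
    \<open>V\<close>, which brings in \<open>b\<close>.\<close>
  have mV: "self_adjoint_op (\<lambda>x. - V x)" "linear (\<lambda>x. - V x)"
    using V by (auto simp: self_adjoint_op_def star_minus intro: linear_compose_neg)
  have VV: "V (V x) = W (W x)" for x
  proof -
    have "W (W x) = x - x * s - x * s + x * (s * s)"
      by (simp add: W_def left_diff_distrib mult.assoc)
    also have "\<dots> = x - 4 *\<^sub>R (x * (k * k)) + 4 *\<^sub>R (x * (k * k * (k * k)))"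
      unfolding ss by (simp add: distrib_left right_diff_distrib)
    also have "\<dots> = V (V x)"
    proof -
      have "4 *\<^sub>R y = 2 *\<^sub>R y + 2 *\<^sub>R y" for y :: 'a by (simp flip: scaleR_add_left)
      then show ?thesis
        by (simp add: V_def left_diff_distrib mult.assoc scaleR_diff_right)
    qed
    finally show ?thesis ..
  qed
  have VW: "V (W x) = W (V x)" for x
    by (simp add: V_def W_def left_diff_distrib mult.assoc skk[unfolded mult.assoc] scaleR_diff_right)
  have Ws: "norm (x - W x) \<le> norm x" for x
    using norm_mult_ineq[of x s] mult_left_mono[OF s(2), of "norm x"] by (simp add: W_def)
  have "x - (1/2) *\<^sub>R (W x - V x) = x - x * u" for x
    by (simp add: V_def W_def u_def right_diff_distrib scaleR_diff_right)
  then show cu: "norm (x - x * u) \<le> norm x" for x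
    using one_minus_negative_part_contractive[OF V W VV VW Ws, of x] by simp
  have "x - (1/2) *\<^sub>R (W x - (- V x)) = x * b" for x
  proof -
    have "x - (1/2) *\<^sub>R (x + x) = 0" by (simp flip: scaleR_2)
    then show ?thesis
      by (simp add: V_def W_def b_def distrib_left scaleR_diff_right scaleR_add_right algebra_simps)
  qed
  then have "norm (x * b) \<le> norm x" for x
    using one_minus_negative_part_contractive[OF mV W _ _ Ws, of x] VV VW linear_neg[OF V(2)] linear_neg[OF W(2)]
    by simp
  then have nb: "norm b \<le> 1" using b by (intro norm_le_1_if_contractive) auto
  have xu: "norm (x * u) \<le> norm x" for x
  proof -
    have "2 *\<^sub>R (x * u) = W x - V x"
      by (simp add: V_def W_def u_def right_diff_distrib scaleR_diff_right)
    then have "norm (2 *\<^sub>R (x * u)) \<le> norm (W x) + norm (V x)"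
      by (metis norm_triangle_ineq4)
    then show ?thesis using cs[of x] ck[of x] by (simp add: V_def W_def)
  qed
  then have nu: "norm u \<le> 1" using u by (intro norm_le_1_if_contractive) auto
  \<comment> \<open>\<open>1 - u^2\<close> is the mean of 1 and \<open>1 - 2u^2\<close>, both
    contractive.\<close>
  have cuu: "norm (x - x * (u * u)) \<le> norm x" for x
  proof -
    have "norm (x - 2 *\<^sub>R (x * (u * u))) \<le> norm x" using double_angle[OF u nu] by metis
    moreover have "2 *\<^sub>R (x - x * (u * u)) = x + (x - 2 *\<^sub>R (x * (u * u)))"
      by (simp add: scaleR_2 algebra_simps)
    ultimately have "norm (2 *\<^sub>R (x - x * (u * u))) \<le> 2 * norm x"
      using norm_triangle_ineq[of x "x - 2 *\<^sub>R (x * (u * u))"] by simp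
    then show ?thesis by simp
  qed
  \<comment> \<open>The positive and negative parts of \<open>v\<close> have product 0.\<close>
  have bu: "b * u = u"
  proof -
    have "4 *\<^sub>R (b * u) = 4 *\<^sub>R (k * k * (k * k)) - s * s"
      by (simp add: b_def u_def distrib_left distrib_right left_diff_distrib right_diff_distrib
          skk scaleR_add_right scaleR_diff_right)
    also have "\<dots> = 4 *\<^sub>R u" unfolding ss
      by (simp add: u_def scaleR_diff_right scaleR_2)
    finally show ?thesis by simp
  qed
  \<comment> \<open>As \<open>k\<close> and \<open>u\<close> commute, \<open>k - k * u\<close> has
    square \<open>?y (1 - u)\<close>, so bounding \<open>?y\<close> suffices.\<close>
  let ?y = "k * k - k * k * u"
  have kk: "2 *\<^sub>R (k * k) = u + b" by (simp add: u_def b_def scaleR_2)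
  have "2 *\<^sub>R ?y = 2 *\<^sub>R (k * k) - 2 *\<^sub>R (k * k) * u" by (simp add: scaleR_diff_right)
  also have "\<dots> = b - b * (u * u)" unfolding kk by (simp add: distrib_right bu flip: mult.assoc)
  finally have "norm (2 *\<^sub>R ?y) \<le> 1" using cuu[of b] nb by simp
  then have ny: "norm ?y \<le> 1/2" by simp
  have uk: "u * k = k * u"
    by (simp add: u_def left_diff_distrib right_diff_distrib s(3) mult.assoc)
  then have ku: "k * u * k = k * k * u" "k * u * (k * u) = k * k * u * u" by (metis mult.assoc)+
  have "star (k - k * u) = k - k * u" using u k uk by (simp add: star_diff star_mult)
  then have "(norm (k - k * u))\<^sup>2 = norm ((k - k * u) * (k - k * u))"
    by (simp add: norm_self_adjoint_square)
  also have "(k - k * u) * (k - k * u) = ?y - ?y * u"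
    by (simp add: left_diff_distrib right_diff_distrib ku flip: mult.assoc)
  also have "norm \<dots> \<le> 1/2" using cu[of ?y] ny by simp
  finally show "(norm (k - k * u))\<^sup>2 \<le> 1/2" .
qed

section \<open>Homomorphisms of C*-algebras\<close>

locale star_hom =
  fixes g :: "'a::cstar_algebra \<Rightarrow> 'b::cstar_algebra"
  assumes hom: "star_hom_on UNIV UNIV g"
begin

lemma add: "g (x + y) = g x + g y" and scaleC: "g (c *\<^sub>C x) = c *\<^sub>C g x"
  and mult: "g (x * y) = g x * g y" and star: "g (star x) = star (g x)"
  using hom by (auto simp: star_hom_on_def linear_map_on_def)

lemma scaleR: "g (r *\<^sub>R x) = r *\<^sub>R g x"
  by (simp add: scaleR_scaleC scaleC)

lemma linear: "linear g"
  by (rule linearI) (auto simp: add scaleR)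

lemmas zero = linear_0[OF linear] and diff = linear_diff[OF linear]

text \<open>A self-adjoint \<open>h\<close> in the unit ball is the sine of a rotation with cosine
  \<open>1 - s\<close>. The algebraic relations survive under \<open>g\<close> and force
  \<open>norm (g h) \<le> 1\<close>; scaling and the C*-identity give the general case.\<close>

lemma contractive: "norm (g x) \<le> norm x"
proof -
  have 1: "norm (g h) \<le> 1" if h: "star h = h" "norm h \<le> 1" for h
  proof -
    have hh: "star (h * h) = h * h" "norm (h * h) \<le> 1"
      using h norm_self_adjoint_square[of h] by (auto simp: star_mult power_le_one)
    obtain s where s: "star s = s" "s * s + h * h = s + s"
      and comm: "\<And>y. y * (h * h) = h * h * y \<Longrightarrow> y * s = s * y"
      using sqrt_one_minus_exists[OF hh] by blast
    have "s * h = h * s" by (rule comm[symmetric]) (simp add: mult.assoc)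
    then show ?thesis
      using h s by (intro rotation_mult_contractive(3)[of "g h" "g s"]) (metis star mult add)+
  qed
  have 2: "norm (g h) \<le> norm h" if h: "star h = h" for h
  proof (cases "h = 0")
    case False
    then have "norm (g ((1 / norm h) *\<^sub>R h)) \<le> 1" using h by (intro 1) (auto simp: star_scaleR)
    then show ?thesis using False by (simp add: scaleR field_simps)
  qed (simp add: zero)
  have "norm (g (star x * x)) \<le> norm (star x * x)" by (rule 2) (simp add: star_mult star_star)
  then have "(norm (g x))\<^sup>2 \<le> (norm x)\<^sup>2" by (simp add: mult star norm_star_mult_self)
  then show ?thesis by (simp add: power2_le_iff_abs_le)
qed

text \<open>Both sides solve \<open>\<sigma>\<^sup>2 - 2\<sigma> = 4 (g k)\<^sup>4 - 4 (g k)\<^sup>2\<close>, and the solution in the unit ball is unique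
  as one side has norm \<open>< 1\<close>.\<close>

lemma hom_abs:
  assumes gk: "2 * (norm (g k))\<^sup>2 < 1" and s: "norm s \<le> 1" "s * k = k * s"
    and sp: "s * s + (4 *\<^sub>R (k * k) - 4 *\<^sub>R (k * k * (k * k))) = s + s"
  shows "g s = 2 *\<^sub>R (g k * g k)"
proof (rule ccontr)
  assume ne: "g s \<noteq> 2 *\<^sub>R (g k * g k)"
  \<comment> \<open>Both \<open>y\<close> and \<open>s\<close> solve
    \<open>z + z - z^2 = 4k^2 - 4k^4\<close>; subtracting the equations leaves the factor
    \<open>y - s\<close>.\<close>
  define y where "y = 2 *\<^sub>R (k * k)"
  have sy: "s * y = y * s" using s(2) unfolding y_def by (metis mult.assoc mult_scaleR_left mult_scaleR_right)
  have "4 *\<^sub>R (k * k) = y + y" by (simp add: y_def flip: scaleR_add_left)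
  then have "(y - s) + (y - s) = y * y - s * s"
    using sp by (simp add: y_def algebra_simps)
  also have "\<dots> = (y - s) * (y + s)" using sy by (simp add: algebra_simps)
  finally have "g (y - s) + g (y - s) = g (y - s) * (g y + g s)" by (metis add mult)
  then have "norm (2 *\<^sub>R g (y - s)) = norm (g (y - s) * (g y + g s))" by (simp add: scaleR_2)
  also have "\<dots> \<le> norm (g (y - s)) * norm (g y + g s)" by (rule norm_mult_ineq)
  finally have "2 * norm (g (y - s)) \<le> norm (g (y - s)) * norm (g y + g s)" by simp
  moreover have "g (y - s) \<noteq> 0" using ne by (simp add: diff y_def scaleR mult)
  ultimately have "2 \<le> norm (g y + g s)" by simp
  also have "\<dots> \<le> norm (g y) + norm (g s)" by (rule norm_triangle_ineq)
  also have "norm (g y) < 1"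
    using norm_mult_ineq[of "g k" "g k"] gk by (simp add: y_def scaleR mult power2_eq_square)
  also have "norm (g s) \<le> 1" using contractive[of s] s by simp
  finally show False by simp
qed

text \<open>If \<open>2 (norm (g k))^2 < 1\<close>, then \<open>s - 2k^2\<close> lies in the trivial
  kernel, and \<open>norm s \<le> 1\<close> bounds \<open>norm k\<close>. A self-adjoint element
  whose norm drops could be rescaled to violate this bound.\<close>

lemma injective_isometric:
  assumes "\<And>x. g x = 0 \<Longrightarrow> x = 0"
  shows "norm (g x) = norm x"
proof -
  have 1: "2 * (norm k)\<^sup>2 \<le> 1" if k: "star k = k" "norm k \<le> 1" and gk: "2 * (norm (g k))\<^sup>2 < 1" for k
  proof -
    obtain s where s: "norm s \<le> 1" "s * k = k * s"
      "s * s + (4 *\<^sub>R (k * k) - 4 *\<^sub>R (k * k * (k * k))) = s + s"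
      using abs_exists[OF k] by metis
    have "g (s - 2 *\<^sub>R (k * k)) = 0" using hom_abs[OF gk s] by (simp add: diff scaleR mult)
    then have "s = 2 *\<^sub>R (k * k)" using assms by force
    then show ?thesis using s(1) norm_self_adjoint_square[OF k(1)] by simp
  qed
  have 2: "norm h \<le> norm (g h)" if h: "star h = h" for h
  proof (rule ccontr)
    assume "\<not> ?thesis"
    moreover from this have "norm h > 0" using norm_ge_zero[of "g h"] by linarith
    \<comment> \<open>For \<open>m\<close> in this gap, scaling by \<open>1 / (sqrt 2 * m)\<close>
      keeps \<open>h\<close> in the unit ball and puts \<open>1 / sqrt 2\<close> strictly between
      the norms of its image and of itself.\<close>
    ultimately have "max (norm (g h)) (norm h / sqrt 2) < norm h"
      using mult_strict_left_mono[of 1 "sqrt 2" "norm h"] by (auto simp: field_simps)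
    then obtain m where m: "max (norm (g h)) (norm h / sqrt 2) < m" "m < norm h" using dense by blast
    then have m0: "m > 0" using norm_ge_zero[of "g h"] by linarith
    define c where "c = 1 / (sqrt 2 * m)"
    have c: "c > 0" "2 * c\<^sup>2 * m\<^sup>2 = 1" using m0 by (auto simp: c_def power_mult_distrib power_divide)
    have "2 * (norm (c *\<^sub>R h))\<^sup>2 \<le> 1"
    proof (rule 1)
      show "star (c *\<^sub>R h) = c *\<^sub>R h" using h by (simp add: star_scaleR)
      show "norm (c *\<^sub>R h) \<le> 1" using m m0 by (simp add: c_def field_simps)
      have "(norm (g h))\<^sup>2 < m\<^sup>2" using m by (intro power_strict_mono) auto
      then have "2 * c\<^sup>2 * (norm (g h))\<^sup>2 < 2 * c\<^sup>2 * m\<^sup>2"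
        using c(1) by (intro mult_strict_left_mono) auto
      then show "2 * (norm (g (c *\<^sub>R h)))\<^sup>2 < 1"
        using c by (simp add: scaleR power_mult_distrib)
    qed
    moreover have "m\<^sup>2 < (norm h)\<^sup>2" using m m0 by (intro power_strict_mono) auto
    then have "2 * c\<^sup>2 * m\<^sup>2 < 2 * c\<^sup>2 * (norm h)\<^sup>2"
      using c(1) by (intro mult_strict_left_mono) auto
    ultimately show False using c by (simp add: power_mult_distrib)
  qed
  have "norm (star x * x) \<le> norm (g (star x * x))" by (rule 2) (simp add: star_mult star_star)
  then have "(norm x)\<^sup>2 \<le> (norm (g x))\<^sup>2" by (simp add: mult star norm_star_mult_self)
  then have "norm x \<le> norm (g x)" by (simp add: power2_le_iff_abs_le)
  with contractive show ?thesis by (rule antisym)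
qed

section \<open>Cutoffs from the kernel\<close>

text \<open>Such \<open>u\<close> act like members of an approximate unit of the kernel: passing
  from \<open>x\<close> to \<open>x - x * u\<close> stays in the coset of \<open>x\<close> and never
  raises the norm.\<close>

definition kernel_multiplier :: "'a \<Rightarrow> bool" where
  "kernel_multiplier u \<longleftrightarrow> g u = 0 \<and> (\<forall>x. norm (x - x * u) \<le> norm x)"

lemma kernel_multiplier_0: "kernel_multiplier 0"
  by (simp add: kernel_multiplier_def zero)

text \<open>\<open>1 - (u + v - u * v) = (1 - u) (1 - v)\<close>.\<close>

lemma kernel_multiplier_compose:
  assumes "kernel_multiplier u" "kernel_multiplier v"
  shows "kernel_multiplier (u + v - u * v)"
    and "x - x * (u + v - u * v) = (x - x * u) - (x - x * u) * v"
proof -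
  show *: "x - x * (u + v - u * v) = (x - x * u) - (x - x * u) * v" for x
    by (simp add: algebra_simps)
  show "kernel_multiplier (u + v - u * v)"
    using assms unfolding kernel_multiplier_def *
    by (auto simp: add diff mult intro: order.trans[of _ "norm (_ - _ * u)"])
qed

text \<open>Scaling \<open>star b * b\<close> by \<open>1 / (sqrt 2 * m^2)\<close> gives
  \<open>k\<close> with \<open>norm k \<le> 1\<close> and \<open>norm (g k) < 1 / sqrt 2\<close>.
  The cutoff of \<open>k\<close> therefore lies in the kernel and lowers the norm to
  \<open>1 / sqrt 2\<close>, which after rescaling is the bound \<open>m^2\<close>.\<close>

lemma kernel_multiplier_step:
  assumes m: "norm (g b) < m" and b: "(norm b)\<^sup>2 \<le> sqrt 2 * m\<^sup>2"
  shows "\<exists>u. kernel_multiplier u \<and> norm (b - b * u) \<le> m"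
proof -
  have m0: "m > 0" using m norm_ge_zero[of "g b"] by linarith
  define c where "c = 1 / (sqrt 2 * m\<^sup>2)"
  have c: "c > 0" "c * (sqrt 2 * m\<^sup>2) = 1" using m0 by (auto simp: c_def)
  let ?h = "star b * b"
  let ?k = "c *\<^sub>R ?h"
  have k: "star ?k = ?k" by (simp add: star_scaleR star_mult star_star)
  have "c * (norm b)\<^sup>2 \<le> c * (sqrt 2 * m\<^sup>2)" using b c by (intro mult_left_mono) auto
  then have nk: "norm ?k \<le> 1" using c by (simp add: norm_star_mult_self)
  obtain s where s: "star s = s" "norm s \<le> 1" "s * ?k = ?k * s"
      "s * s + (4 *\<^sub>R (?k * ?k) - 4 *\<^sub>R (?k * ?k * (?k * ?k))) = s + s"
    "\<And>x. norm (x - x * s) \<le> norm x" "\<And>x. norm (x - 2 *\<^sub>R (x * (?k * ?k))) \<le> norm x"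
    using abs_exists[OF k nk] by metis
  define u where "u = ?k * ?k - (1/2) *\<^sub>R s"
  note cut = cutoff[OF k s, folded u_def]
  have "(norm (g b))\<^sup>2 < m\<^sup>2" using m by (intro power_strict_mono) auto
  then have "(sqrt 2 * c) * (norm (g b))\<^sup>2 < (sqrt 2 * c) * m\<^sup>2"
    using c by (intro mult_strict_left_mono) auto
  then have "sqrt 2 * norm (g ?k) < 1"
    using c by (simp add: scaleR mult star norm_star_mult_self mult_ac)
  then have "(sqrt 2 * norm (g ?k))\<^sup>2 < 1" by (intro power_less_one_iff[THEN iffD2]) auto
  then have "2 * (norm (g ?k))\<^sup>2 < 1" by (simp add: power_mult_distrib)
  from hom_abs[OF this s(2-4)] have "g u = 0" by (simp add: u_def diff scaleR mult)
  with cut(2) have ker: "kernel_multiplier u" by (simp add: kernel_multiplier_def)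
  have left: "norm (y - u * y) \<le> norm y" for y
    using cut(2)[of "star y"] cut(1) norm_star[of "y - u * y"]
    by (simp add: star_diff star_mult norm_star)
  have "(norm (?k - ?k * u))\<^sup>2 \<le> (1 / sqrt 2)\<^sup>2" using cut(3) by (simp add: power_divide)
  then have "norm (?k - ?k * u) \<le> 1 / sqrt 2" by (simp add: power2_le_iff_abs_le)
  then have "c * norm (?h - ?h * u) \<le> 1 / sqrt 2"
    using c by (simp flip: scaleR_diff_right)
  then have "norm (?h - ?h * u) \<le> m\<^sup>2" using m0 by (simp add: c_def field_simps)
  \<comment> \<open>By the C*-identity this is the norm of
    \<open>(1 - u) (star b * b) (1 - u)\<close>.\<close>
  moreover have "(norm (b - b * u))\<^sup>2 = norm ((?h - ?h * u) - u * (?h - ?h * u))"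
    using cut(1) by (simp add: star_diff star_mult algebra_simps flip: norm_star_mult_self)
  ultimately have "(norm (b - b * u))\<^sup>2 \<le> m\<^sup>2" using left[of "?h - ?h * u"] by simp
  then show ?thesis using ker m0 by (auto simp: power2_le_iff_abs_le)
qed

text \<open>One step lowers the bound by the factor \<open>2^(1/4)\<close> without changing
  \<open>g b\<close>; finitely many steps bring it down to \<open>m\<close>.\<close>

lemma kernel_multiplier_single:
  assumes "norm (g b) < m"
  shows "\<exists>u. kernel_multiplier u \<and> norm (b - b * u) \<le> m"
proof -
  have m0: "m > 0" using assms norm_ge_zero[of "g b"] by linarith
  define r where "r = sqrt (sqrt 2)"
  have r: "r > 1" "r\<^sup>2 = sqrt 2" by (auto simp: r_def)
  have "\<exists>u. kernel_multiplier u \<and> norm (b - b * u) \<le> m"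
    if "norm b \<le> r ^ n * m" "norm (g b) < m" for n b
    using that
  proof (induction n arbitrary: b)
    case 0
    then show ?case using kernel_multiplier_0 by (intro exI[of _ 0]) auto
  next
    case (Suc n)
    have "(norm b)\<^sup>2 \<le> (r ^ Suc n * m)\<^sup>2" using Suc.prems(1) by (intro power_mono) auto
    also have "\<dots> = sqrt 2 * (r ^ n * m)\<^sup>2"
      by (simp add: power_mult_distrib flip: r(2))
    finally have 1: "(norm b)\<^sup>2 \<le> sqrt 2 * (r ^ n * m)\<^sup>2" .
    have "1 * m \<le> r ^ n * m" using r m0 by (intro mult_right_mono one_le_power) auto
    then have "norm (g b) < r ^ n * m" using Suc.prems by simp
    from kernel_multiplier_step[OF this 1] obtain u where
      u: "kernel_multiplier u" "norm (b - b * u) \<le> r ^ n * m" by blast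
    have "g (b - b * u) = g b" using u(1) by (simp add: kernel_multiplier_def diff mult)
    with Suc.IH[OF u(2)] Suc.prems(2) obtain v where
      "kernel_multiplier v" "norm ((b - b * u) - (b - b * u) * v) \<le> m" by auto
    then show ?case using kernel_multiplier_compose[OF u(1)] by metis
  qed
  moreover obtain n where "norm b / m < r ^ n" using real_arch_pow[OF r(1)] by blast
  then have "norm b \<le> r ^ n * m" using m0 by (simp add: field_simps)
  ultimately show ?thesis using assms by blast
qed

text \<open>Elements are treated one at a time: a later factor \<open>1 - v\<close> is contractive
  and cannot spoil earlier estimates.\<close>

lemma kernel_multiplier_finite:
  assumes "finite B" "\<epsilon> > 0"
  shows "\<exists>u. kernel_multiplier u \<and> (\<forall>b\<in>B. norm (b - b * u) \<le> norm (g b) + \<epsilon>)"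
  using assms(1)
proof induction
  case empty
  then show ?case using kernel_multiplier_0 by blast
next
  case (insert b B)
  then obtain u where u: "kernel_multiplier u" "\<forall>b\<in>B. norm (b - b * u) \<le> norm (g b) + \<epsilon>" by blast
  have "g (b - b * u) = g b" using u(1) by (simp add: kernel_multiplier_def diff mult)
  with kernel_multiplier_single[of "b - b * u" "norm (g b) + \<epsilon>"] assms(2) obtain v where
    v: "kernel_multiplier v" "norm ((b - b * u) - (b - b * u) * v) \<le> norm (g b) + \<epsilon>" by auto
  have "norm ((x - x * u) - (x - x * u) * v) \<le> norm (x - x * u)" for x
    using v(1) by (simp add: kernel_multiplier_def)
  then show ?case
    using v u kernel_multiplier_compose[OF u(1) v(1)] by (metis insert_iff order.trans)
qed

text \<open>Totally bounded sets reduce to finite ones since \<open>x \<mapsto> x - x u\<close> and \<open>g\<close> are contractive.\<close>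

lemma kernel_multiplier_compact:
  assumes "compact B" "\<epsilon> > 0"
  shows "\<exists>u. kernel_multiplier u \<and> (\<forall>b\<in>B. norm (b - b * u) \<le> norm (g b) + \<epsilon>)"
proof -
  obtain A where A: "finite A" "B \<subseteq> (\<Union>a\<in>A. ball a (\<epsilon> / 3))"
    using assms compact_eq_totally_bounded[of B] by (metis divide_pos_pos zero_less_numeral)
  obtain u where u: "kernel_multiplier u" "\<And>a. a \<in> A \<Longrightarrow> norm (a - a * u) \<le> norm (g a) + \<epsilon> / 3"
    using kernel_multiplier_finite[OF A(1), of "\<epsilon> / 3"] assms(2) by auto
  have "norm (b - b * u) \<le> norm (g b) + \<epsilon>" if b: "b \<in> B" for b
  proof -
    obtain a where a: "a \<in> A" "norm (b - a) < \<epsilon> / 3"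
      using A(2) b by (auto simp: dist_norm norm_minus_commute)
    have "b - b * u = ((b - a) - (b - a) * u) + (a - a * u)" by (simp add: algebra_simps)
    then have "norm (b - b * u) \<le> norm ((b - a) - (b - a) * u) + norm (a - a * u)"
      by (metis norm_triangle_ineq)
    also have "\<dots> \<le> norm (b - a) + (norm (g a) + \<epsilon> / 3)"
      using u a by (intro add_mono) (auto simp: kernel_multiplier_def)
    also have "norm (g a) \<le> norm (g b) + norm (b - a)"
      using norm_triangle_ineq4[of "g b" "g (b - a)"] contractive[of "b - a"] by (simp add: diff)
    finally show ?thesis using a by simp
  qed
  with u show ?thesis by blast
qed

lemma lift_with_norm_bound:
  assumes "surj g" "\<epsilon> > 0"
  obtains b where "g b = c" "norm b \<le> norm c + \<epsilon>"
proof -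
  obtain b where b: "g b = c" using assms(1) by (metis surjD)
  obtain u where u: "kernel_multiplier u" "norm (b - b * u) \<le> norm c + \<epsilon>"
    using kernel_multiplier_single[of b "norm c + \<epsilon>"] b assms(2) by auto
  show thesis
    by (rule that[of "b - b * u"]) (use b u in \<open>auto simp: kernel_multiplier_def diff mult\<close>)
qed

end

section \<open>Summable power series\<close>

lemma summable_series_terms:
  assumes "F \<in> summable_series" "\<bar>t\<bar> \<le> 1"
  shows "summable (\<lambda>n. norm (t ^ n *\<^sub>R fps_nth F n))" "summable (\<lambda>n. t ^ n *\<^sub>R fps_nth F n)"
    "(\<lambda>n. t ^ n *\<^sub>R fps_nth F n) sums eval_series F t"
proof -
  have le: "norm (t ^ n *\<^sub>R fps_nth F n) \<le> norm (fps_nth F n)" for n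
    using assms(2) by (simp add: power_abs power_le_one mult_left_le_one_le)
  show *: "summable (\<lambda>n. norm (t ^ n *\<^sub>R fps_nth F n))"
    using assms(1) le by (auto simp: summable_series_def intro: summable_comparison_test'[where N = 0])
  then show "summable (\<lambda>n. t ^ n *\<^sub>R fps_nth F n)" by (rule summable_norm_cancel)
  then show "(\<lambda>n. t ^ n *\<^sub>R fps_nth F n) sums eval_series F t"
    by (simp add: eval_series_def summable_sums)
qed

lemma eval_seriesI:
  assumes "(\<lambda>n. t ^ n *\<^sub>R fps_nth F n) sums y"
  shows "eval_series F t = y"
  using assms by (simp add: eval_series_def sums_iff)

lemma norm_eval_series_le:
  assumes F: "F \<in> summable_series" and t: "\<bar>t\<bar> \<le> 1"
  shows "norm (eval_series F t) \<le> (\<Sum>n. norm (fps_nth F n))"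
proof -
  have "norm (eval_series F t) \<le> (\<Sum>n. norm (t ^ n *\<^sub>R fps_nth F n))"
    unfolding eval_series_def by (rule summable_norm[OF summable_series_terms(1)[OF F t]])
  also have "\<dots> \<le> (\<Sum>n. norm (fps_nth F n))"
    using F t by (intro suminf_le summable_series_terms(1)[OF F t])
      (auto simp: summable_series_def power_abs power_le_one mult_left_le_one_le)
  finally show ?thesis .
qed

lemma continuous_on_eval_series:
  assumes F: "F \<in> summable_series"
  shows "continuous_on {-1..1} (eval_series F)"
proof -
  have "uniform_limit {-1..1} (\<lambda>n t. \<Sum>i<n. t ^ i *\<^sub>R fps_nth F i) (\<lambda>t. \<Sum>i. t ^ i *\<^sub>R fps_nth F i) sequentially"
  proof (rule Weierstrass_m_test)
    show "norm (t ^ n *\<^sub>R fps_nth F n) \<le> norm (fps_nth F n)" if "t \<in> {-1..1}" for n and t :: real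
      using that by (simp add: power_abs power_le_one mult_left_le_one_le abs_le_iff)
    show "summable (\<lambda>n. norm (fps_nth F n))" using F by (simp add: summable_series_def)
  qed
  then have "continuous_on {-1..1} (\<lambda>t. \<Sum>i. t ^ i *\<^sub>R fps_nth F i)"
    by (rule uniform_limit_theorem[rotated]) (auto intro!: continuous_intros always_eventually)
  then show ?thesis by (simp add: eval_series_def[abs_def])
qed

lemma summable_series_0: "0 \<in> summable_series"
  by (simp add: summable_series_def)

lemma summable_series_add:
  assumes "F \<in> summable_series" "G \<in> summable_series"
  shows "F + G \<in> summable_series"
proof -
  have "summable (\<lambda>n. norm (fps_nth F n) + norm (fps_nth G n))"
    using assms by (intro summable_add) (auto simp: summable_series_def)
  then show ?thesis
    by (auto simp: summable_series_def norm_triangle_ineq intro: summable_comparison_test'[where N = 0])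
qed

lemma summable_series_scaleC:
  assumes "F \<in> summable_series"
  shows "c *\<^sub>C F \<in> summable_series"
  using assms by (auto simp: summable_series_def scaleC_fps_def norm_scaleC intro: summable_mult)

lemma summable_series_star:
  assumes "F \<in> summable_series"
  shows "star F \<in> summable_series"
  using assms by (auto simp: summable_series_def star_fps_def norm_star)

lemma summable_series_mult:
  assumes "F \<in> summable_series" "G \<in> summable_series"
  shows "F * G \<in> summable_series"
proof -
  have "summable (\<lambda>n. \<Sum>i\<le>n. norm (fps_nth F i) * norm (fps_nth G (n - i)))"
    using assms summable_Cauchy_product[of "\<lambda>n. norm (fps_nth F n)" "\<lambda>n. norm (fps_nth G n)"]
    by (simp add: summable_series_def)
  moreover have "norm (fps_nth (F * G) n) \<le> (\<Sum>i\<le>n. norm (fps_nth F i) * norm (fps_nth G (n - i)))" for n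
    unfolding fps_mult_nth atLeast0AtMost
    by (intro order.trans[OF norm_sum] sum_mono norm_mult_ineq)
  ultimately show ?thesis
    unfolding summable_series_def by (auto intro: summable_comparison_test'[where N = 0])
qed

lemma summable_series_fps_shift:
  assumes "F \<in> summable_series"
  shows "fps_shift k F \<in> summable_series"
  using assms by (simp add: summable_series_def summable_iff_shift[of "\<lambda>n. norm (fps_nth F n)"])

lemma eval_series_add:
  assumes "F \<in> summable_series" "G \<in> summable_series" "\<bar>t\<bar> \<le> 1"
  shows "eval_series (F + G) t = eval_series F t + eval_series G t"
  using sums_add[OF summable_series_terms(3)[OF assms(1,3)] summable_series_terms(3)[OF assms(2,3)]]
  by (intro eval_seriesI) (simp add: scaleR_add_right)

lemma eval_series_scaleC:
  assumes "F \<in> summable_series" "\<bar>t\<bar> \<le> 1"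
  shows "eval_series (c *\<^sub>C F) t = c *\<^sub>C eval_series F t"
  using bounded_linear.sums[OF bounded_linear_scaleC summable_series_terms(3)[OF assms]]
  by (intro eval_seriesI) (simp add: scaleC_fps_def scaleR_scaleC scaleC_scaleC mult.commute)

lemma eval_series_star:
  assumes "F \<in> summable_series" "\<bar>t\<bar> \<le> 1"
  shows "eval_series (star F) t = star (eval_series F t)"
  using bounded_linear.sums[OF bounded_linear_star summable_series_terms(3)[OF assms]]
  by (intro eval_seriesI) (simp add: star_fps_def star_scaleR)

lemma eval_series_mult:
  assumes "F \<in> summable_series" "G \<in> summable_series" "\<bar>t\<bar> \<le> 1"
  shows "eval_series (F * G) t = eval_series F t * eval_series G t"
proof (rule eval_seriesI)
  have "(\<lambda>n. \<Sum>i\<le>n. t ^ i *\<^sub>R fps_nth F i * t ^ (n - i) *\<^sub>R fps_nth G (n - i))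
    sums (eval_series F t * eval_series G t)"
    using Cauchy_product_sums[OF summable_series_terms(1)[OF assms(1,3)] summable_series_terms(1)[OF assms(2,3)]]
    by (simp add: eval_series_def)
  moreover have "(\<Sum>i\<le>n. t ^ i *\<^sub>R fps_nth F i * t ^ (n - i) *\<^sub>R fps_nth G (n - i)) = t ^ n *\<^sub>R fps_nth (F * G) n" for n
    unfolding fps_mult_nth atLeast0AtMost scaleR_sum_right
    by (intro sum.cong) (auto simp flip: power_add)
  ultimately show "(\<lambda>n. t ^ n *\<^sub>R fps_nth (F * G) n) sums (eval_series F t * eval_series G t)" by simp
qed

lemma eval_series_0 [simp]: "eval_series 0 t = 0"
  by (simp add: eval_series_def)

lemma eval_series_at_0:
  assumes "F \<in> summable_series"
  shows "eval_series F 0 = fps_nth F 0"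
proof (rule eval_seriesI)
  have "(\<lambda>n. 0 ^ n *\<^sub>R fps_nth F n) = (\<lambda>n. if n = 0 then fps_nth F n else 0)" by auto
  then show "(\<lambda>n. 0 ^ n *\<^sub>R fps_nth F n) sums fps_nth F 0" by (simp add: sums_single)
qed

lemma eval_series_fps_shift:
  assumes "F \<in> summable_series" "\<bar>t\<bar> \<le> 1"
  shows "eval_series F t = fps_nth F 0 + t *\<^sub>R eval_series (fps_shift 1 F) t"
proof -
  have "(\<lambda>n. t *\<^sub>R (t ^ n *\<^sub>R fps_nth (fps_shift 1 F) n)) sums (t *\<^sub>R eval_series (fps_shift 1 F) t)"
    by (intro sums_scaleR_right summable_series_terms(3) summable_series_fps_shift assms)
  then have "(\<lambda>n. t ^ Suc n *\<^sub>R fps_nth F (Suc n)) sums (t *\<^sub>R eval_series (fps_shift 1 F) t)"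
    by simp
  then show ?thesis
    using sums_Suc_iff[of "\<lambda>n. t ^ n *\<^sub>R fps_nth F n"] by (intro eval_seriesI) (simp add: add.commute)
qed

text \<open>Identity theorem: continuity at the limit point 0 kills the constant coefficient, and
  division by \<open>t\<close> passes to the next one. It makes the norm over \<open>K\<close>
  definite.\<close>

lemma eval_series_eq_0_imp_eq_0:
  assumes K: "K \<subseteq> {-1..1}" "0 islimpt K" and F: "F \<in> summable_series"
    and zero: "\<And>t. t \<in> K \<Longrightarrow> eval_series F t = 0"
  shows "F = 0"
proof -
  \<comment> \<open>Only \<open>K - {0}\<close> is used, since the vanishing of the shifted series
    is obtained by dividing by \<open>t\<close>.\<close>
  have nth_0: "fps_nth F 0 = 0"
    if 0: "F \<in> summable_series" "\<And>t. t \<in> K - {0} \<Longrightarrow> eval_series F t = 0" for F :: "'a fps"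
  proof -
    have "(eval_series F \<longlongrightarrow> eval_series F 0) (at 0 within K - {0})"
      using continuous_on_eval_series[OF 0(1)] K(1)
      by (auto simp: continuous_on_def intro: tendsto_within_subset[where S = "{-1..1}"])
    moreover have "(eval_series F \<longlongrightarrow> 0) (at 0 within K - {0})"
      using 0(2) by (intro tendsto_eventually) (simp add: eventually_at_filter)
    moreover have "at 0 within K - {0} \<noteq> bot"
      using K(2) by (simp add: trivial_limit_within islimpt_punctured[symmetric])
    ultimately show ?thesis using tendsto_unique eval_series_at_0[OF 0(1)] by metis
  qed
  have "fps_nth F n = 0" if "F \<in> summable_series" "\<And>t. t \<in> K - {0} \<Longrightarrow> eval_series F t = 0"
    for n and F :: "'a fps"
    using that
  proof (induction n arbitrary: F)
    case 0
    then show ?case by (rule nth_0)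
  next
    case (Suc n)
    have F0: "fps_nth F 0 = 0" using Suc.prems by (rule nth_0)
    have "eval_series (fps_shift 1 F) t = 0" if "t \<in> K - {0}" for t
      using eval_series_fps_shift[OF Suc.prems(1), of t] Suc.prems(2)[OF that] that K(1) F0
      by (auto simp: abs_le_iff)
    from Suc.IH[OF summable_series_fps_shift[OF Suc.prems(1)] this] show ?case by simp
  qed
  then show ?thesis using F zero by (auto simp: fps_eq_iff)
qed

section \<open>The supremum norm over \<open>K\<close>\<close>

lemma bdd_above_eval_series:
  assumes "K \<subseteq> {-1..1}" "F \<in> summable_series"
  shows "bdd_above ((\<lambda>t. norm (eval_series F t)) ` K)"
  using assms norm_eval_series_le[OF assms(2)] by (intro bdd_aboveI2) (force simp: abs_le_iff)

lemma norm_on_upper: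
  assumes "K \<subseteq> {-1..1}" "F \<in> summable_series" "t \<in> K"
  shows "norm (eval_series F t) \<le> norm_on K F"
  unfolding norm_on_def by (intro cSUP_upper bdd_above_eval_series assms)

lemma norm_on_least:
  assumes "K \<noteq> {}" "\<And>t. t \<in> K \<Longrightarrow> norm (eval_series F t) \<le> c"
  shows "norm_on K F \<le> c"
  unfolding norm_on_def by (intro cSUP_least assms)

lemma norm_on_nonneg:
  assumes "K \<noteq> {}" "K \<subseteq> {-1..1}" "F \<in> summable_series"
  shows "0 \<le> norm_on K F"
  using assms norm_on_upper[OF assms(2,3)] norm_ge_zero order.trans by blast

lemma pre_cstar_algebra_summable_series:
  assumes K: "K \<subseteq> {-1..1}" "0 islimpt K"
  shows "pre_cstar_algebra (summable_series :: 'a::cstar_algebra fps set) (norm_on K)"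
proof -
  have ne: "K \<noteq> {}" using K(2) by auto
  have t: "\<bar>t\<bar> \<le> 1" if "t \<in> K" for t using that K(1) by (auto simp: abs_le_iff)
  note up = norm_on_upper[OF K(1)] and least = norm_on_least[OF ne] and nn = norm_on_nonneg[OF ne K(1)]
  have scale_le: "norm_on K (c *\<^sub>C F) \<le> cmod c * norm_on K F" if "F \<in> summable_series" for c and F :: "'a fps"
    using that by (intro least) (simp add: eval_series_scaleC t norm_scaleC up mult_left_mono)
  have scale: "norm_on K (c *\<^sub>C F) = cmod c * norm_on K F" if F: "F \<in> summable_series" for c and F :: "'a fps"
  proof (cases "c = 0")
    case True
    then show ?thesis using scale_le[OF F, of c] nn[OF summable_series_scaleC[OF F, of c]] by simp
  next
    case False
    then have "norm_on K F \<le> norm_on K (c *\<^sub>C F) / cmod c"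
      using scale_le[OF summable_series_scaleC[OF F], of "1 / c" c]
      by (simp add: scaleC_scaleC scaleC_one norm_divide)
    then show ?thesis using False scale_le[OF F, of c] by (simp add: field_simps)
  qed
  have zero: "norm_on K F = 0 \<longleftrightarrow> F = 0" if F: "F \<in> summable_series" for F :: "'a fps"
  proof
    assume 0: "norm_on K F = 0"
    show "F = 0"
      by (rule eval_series_eq_0_imp_eq_0[OF K F]) (use up[OF F] 0 in force)
  qed (use ne in \<open>simp add: norm_on_def\<close>)
  have tri: "norm_on K (F + G) \<le> norm_on K F + norm_on K G"
    if "F \<in> summable_series" "G \<in> summable_series" for F G :: "'a fps"
    using that by (intro least) (simp add: eval_series_add t order.trans[OF norm_triangle_ineq] add_mono up)
  have mult: "norm_on K (F * G) \<le> norm_on K F * norm_on K G"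
    if "F \<in> summable_series" "G \<in> summable_series" for F G :: "'a fps"
    using that by (intro least) (simp add: eval_series_mult t order.trans[OF norm_mult_ineq] mult_mono up nn)
  have cstar: "norm_on K (star F * F) = (norm_on K F)\<^sup>2" if F: "F \<in> summable_series" for F :: "'a fps"
  proof (rule antisym)
    have ev: "norm (eval_series (star F * F) t) = (norm (eval_series F t))\<^sup>2" if "t \<in> K" for t
      using that F by (simp add: eval_series_mult eval_series_star summable_series_star t norm_star_mult_self)
    show "norm_on K (star F * F) \<le> (norm_on K F)\<^sup>2"
      using F by (intro least) (simp add: ev power_mono up)
    have SF: "star F * F \<in> summable_series" using F by (intro summable_series_mult summable_series_star)
    have "norm_on K F \<le> sqrt (norm_on K (star F * F))"
      using up[OF SF] by (intro least real_le_rsqrt) (simp add: ev)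
    then have "(norm_on K F)\<^sup>2 \<le> (sqrt (norm_on K (star F * F)))\<^sup>2" using nn[OF F] by (rule power_mono)
    then show "(norm_on K F)\<^sup>2 \<le> norm_on K (star F * F)" using nn[OF SF] by simp
  qed
  show ?thesis
    unfolding pre_cstar_algebra_def
    by (simp add: summable_series_0 summable_series_add summable_series_mult summable_series_scaleC
        summable_series_star nn zero scale tri mult cstar)
qed

lemma norm_on_0: "K \<noteq> {} \<Longrightarrow> norm_on K 0 = 0"
  by (simp add: norm_on_def)

section \<open>Induced maps on power series\<close>

context star_hom
begin

lemma lift_nth: "fps_nth (lift_series g F) n = g (fps_nth F n)"
  by (simp add: lift_series_def)

lemma lift_summable:
  assumes "F \<in> summable_series"
  shows "lift_series g F \<in> summable_series"
  using assms unfolding summable_series_def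
  by (auto simp: lift_nth contractive intro: summable_comparison_test'[where N = 0])

lemma bounded_linear: "bounded_linear g"
  by (rule bounded_linear_intro[where K = 1]) (auto simp: add scaleR contractive)

lemma eval_lift:
  assumes "F \<in> summable_series" "\<bar>t\<bar> \<le> 1"
  shows "eval_series (lift_series g F) t = g (eval_series F t)"
  using bounded_linear.sums[OF bounded_linear summable_series_terms(3)[OF assms]]
  by (intro eval_seriesI) (simp add: lift_nth scaleR)

lemma lift_star_hom: "star_hom_on summable_series summable_series (lift_series g)"
  unfolding star_hom_on_def linear_map_on_def
  by (auto simp: lift_summable fps_eq_iff lift_nth add scaleC star scaleC_fps_def star_fps_def
      fps_mult_nth linear_sum[OF linear] mult)

lemma lift_linear_map: "linear_map_on summable_series summable_series (lift_series g)"
  using lift_star_hom by (simp add: star_hom_on_def)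

lemma norm_on_lift_le:
  assumes "K \<noteq> {}" "K \<subseteq> {-1..1}" "F \<in> summable_series"
  shows "norm_on K (lift_series g F) \<le> norm_on K F"
proof (rule norm_on_least[OF assms(1)])
  fix t assume t: "t \<in> K"
  then have "\<bar>t\<bar> \<le> 1" using assms(2) by (auto simp: abs_le_iff)
  then show "norm (eval_series (lift_series g F) t) \<le> norm_on K F"
    using order.trans[OF contractive norm_on_upper[OF assms(2,3) t]] by (simp add: eval_lift assms(3))
qed

text \<open>Multiplying all coefficients by \<open>- u\<close> on the right gives \<open>M\<close>
  with \<open>(F + M)(t) = F(t) - F(t) u\<close>, so one \<open>u\<close> has to serve all values
  \<open>F(t)\<close>.\<close>

lemma lift_almost_norm_preserving:
  assumes K: "K \<noteq> {}" "K \<subseteq> {-1..1}" and F: "F \<in> summable_series" and \<epsilon>: "\<epsilon> > 0"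
  obtains M where "M \<in> kernel_on summable_series (lift_series g)"
    "norm_on K (F + M) \<le> norm_on K (lift_series g F) + \<epsilon>"
proof -
  \<comment> \<open>The whole interval supplies compactness, as \<open>K\<close> need not be
    closed.\<close>
  have "compact (eval_series F ` {-1..1})"
    using compact_continuous_image[OF continuous_on_eval_series[OF F]] by simp
  from kernel_multiplier_compact[OF this \<epsilon>] obtain u where u: "kernel_multiplier u"
    "\<forall>b \<in> eval_series F ` {-1..1}. norm (b - b * u) \<le> norm (g b) + \<epsilon>" by blast
  define M where "M = F * fps_const (- u)"
  have M: "M \<in> summable_series"
    unfolding M_def using F by (intro summable_series_mult)
      (auto simp: summable_series_def intro!: summable_finite[of "{0}"] split: if_splits)
  have "lift_series g M = 0"
    using u(1) by (simp add: fps_eq_iff lift_nth M_def kernel_multiplier_def mult diff linear_neg[OF linear])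
  then have ker: "M \<in> kernel_on summable_series (lift_series g)" using M by (simp add: kernel_on_def)
  have "norm (eval_series (F + M) t) \<le> norm_on K (lift_series g F) + \<epsilon>" if t: "t \<in> K" for t
  proof -
    have t1: "\<bar>t\<bar> \<le> 1" using t K(2) by (auto simp: abs_le_iff)
    have "eval_series M t = - (eval_series F t * u)"
    proof (rule eval_seriesI)
      show "(\<lambda>n. t ^ n *\<^sub>R fps_nth M n) sums - (eval_series F t * u)"
        using sums_minus[OF sums_mult2[OF summable_series_terms(3)[OF F t1]], of u] by (simp add: M_def)
    qed
    then have "norm (eval_series (F + M) t) \<le> norm (g (eval_series F t)) + \<epsilon>"
      using u(2) t K(2) by (simp add: eval_series_add F M t1 subset_iff)
    also have "norm (g (eval_series F t)) \<le> norm_on K (lift_series g F)"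
      using norm_on_upper[OF K(2) lift_summable[OF F] t] by (simp add: eval_lift F t1)
    finally show ?thesis by simp
  qed
  then show thesis by (intro that[OF ker] norm_on_least[OF K(1)])
qed

text \<open>All elements of a coset have the same image, so contractivity gives one inequality; the
  other comes from representatives that are optimal up to \<open>\<epsilon>\<close>.\<close>

lemma normal_lift:
  assumes K: "K \<noteq> {}" "K \<subseteq> {-1..1}"
  shows "normal_map_on summable_series (norm_on K) (norm_on K) (lift_series g)"
  unfolding normal_map_on_def quotient_norm_def
proof
  fix F :: "'a fps" assume F: "F \<in> summable_series"
  let ?C = "coset (kernel_on summable_series (lift_series g)) F"
  have lift_add: "lift_series g (F + M) = lift_series g F + lift_series g M" for M
    by (simp add: fps_eq_iff lift_nth add)
  have lower: "norm_on K (lift_series g F) \<le> norm_on K z" if "z \<in> ?C" for z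
  proof -
    from that obtain M where M: "z = F + M" "M \<in> summable_series" "lift_series g M = 0"
      by (auto simp: coset_def kernel_on_def)
    then have "lift_series g F = lift_series g z" by (simp add: lift_add)
    then show ?thesis using norm_on_lift_le[OF K summable_series_add[OF F M(2)]] M(1) by simp
  qed
  have near: "\<exists>z\<in>?C. norm_on K z \<le> norm_on K (lift_series g F) + \<epsilon>" if "\<epsilon> > 0" for \<epsilon>
    using lift_almost_norm_preserving[OF K F that] by (metis coset_def imageI)
  then have "?C \<noteq> {}" by (metis empty_iff zero_less_one)
  then have "norm_on K (lift_series g F) \<le> (INF z\<in>?C. norm_on K z)"
    by (rule cINF_greatest) (rule lower)
  moreover have "(INF z\<in>?C. norm_on K z) \<le> norm_on K (lift_series g F) + \<epsilon>" if "\<epsilon> > 0" for \<epsilon>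
    using near[OF that] lower by (auto intro!: cINF_lower2 bdd_belowI2)
  ultimately show "norm_on K (lift_series g F) = (INF z\<in>?C. norm_on K z)"
    by (meson antisym field_le_epsilon)
qed

text \<open>Coefficients are lifted separately with errors \<open>(1/2)^n\<close>, which keeps the
  norms summable.\<close>

lemma lift_surj:
  assumes "surj g"
  shows "lift_series g ` summable_series = summable_series"
proof (intro equalityI subsetI)
  fix H :: "'b fps" assume H: "H \<in> summable_series"
  have "\<forall>n. \<exists>b. g b = fps_nth H n \<and> norm b \<le> norm (fps_nth H n) + (1/2) ^ n"
    using lift_with_norm_bound[OF assms] by (metis zero_less_divide_1_iff zero_less_numeral zero_less_power)
  then obtain b where b: "\<And>n. g (b n) = fps_nth H n" "\<And>n. norm (b n) \<le> norm (fps_nth H n) + (1/2) ^ n"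
    by metis
  have "summable (\<lambda>n. norm (fps_nth H n) + (1/2) ^ n)"
    using H by (intro summable_add) (auto simp: summable_series_def)
  then have "Abs_fps b \<in> summable_series"
    using b(2) by (auto simp: summable_series_def intro: summable_comparison_test'[where N = 0])
  moreover have "lift_series g (Abs_fps b) = H" by (simp add: fps_eq_iff lift_nth b)
  ultimately show "H \<in> lift_series g ` summable_series" by blast
qed (use lift_summable in blast)

end

section \<open>Exactness and normality of the lifted sequence\<close>

text \<open>Exactness holds coefficientwise; the issue is summability of the chosen preimages. In
  the middle it follows because \<open>f\<close> is isometric, on the right from almost
  norm-preserving lifts.\<close>

lemma short_exact_lift:
  fixes f :: "'a::cstar_algebra \<Rightarrow> 'b::cstar_algebra" and g :: "'b \<Rightarrow> 'c::cstar_algebra"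
  assumes "short_exact_cstar f g"
  shows "short_exact_on summable_series summable_series summable_series (lift_series f) (lift_series g)"
proof -
  interpret f: star_hom f using assms by unfold_locales (simp add: short_exact_cstar_def)
  interpret g: star_hom g using assms by unfold_locales (simp add: short_exact_cstar_def)
  have inj: "x = 0" if "f x = 0" for x
    using assms that by (auto simp: short_exact_cstar_def short_exact_on_def kernel_on_def)
  have ker: "g y = 0 \<longleftrightarrow> y \<in> range f" for y
    using assms by (auto simp: short_exact_cstar_def short_exact_on_def kernel_on_def)
  have surj: "surj g"
    using assms by (auto simp: short_exact_cstar_def short_exact_on_def kernel_on_def)
  have "kernel_on summable_series (lift_series f) = {0}"
    using inj by (auto simp: kernel_on_def fps_eq_iff f.lift_nth f.zero summable_series_0)
  moreover have "lift_series f ` summable_series = kernel_on summable_series (lift_series g)"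
  proof (intro equalityI subsetI)
    fix G assume "G \<in> lift_series f ` summable_series"
    then show "G \<in> kernel_on summable_series (lift_series g)"
      using ker by (auto simp: kernel_on_def f.lift_summable fps_eq_iff f.lift_nth g.lift_nth)
  next
    fix G assume G: "G \<in> kernel_on summable_series (lift_series g)"
    then have "\<forall>n. \<exists>a. f a = fps_nth G n"
      using ker by (auto simp: kernel_on_def fps_eq_iff g.lift_nth) (metis rangeE)
    then obtain a where a: "\<And>n. f (a n) = fps_nth G n" by metis
    then have "norm (a n) = norm (fps_nth G n)" for n using f.injective_isometric[OF inj] by metis
    then have "Abs_fps a \<in> summable_series" using G by (simp add: kernel_on_def summable_series_def)
    moreover have "lift_series f (Abs_fps a) = G" by (simp add: fps_eq_iff f.lift_nth a)
    ultimately show "G \<in> lift_series f ` summable_series" by blast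
  qed
  ultimately show ?thesis
    using g.lift_surj[OF surj] by (simp add: short_exact_on_def kernel_on_def)
qed

lemma normal_short_exact_lift:
  fixes f :: "'a::cstar_algebra \<Rightarrow> 'b::cstar_algebra" and g :: "'b \<Rightarrow> 'c::cstar_algebra"
  assumes K: "K \<noteq> {}" "K \<subseteq> {-1..1}" and ex: "short_exact_cstar f g"
  shows "normal_short_exact_on summable_series (norm_on K) summable_series (norm_on K)
      summable_series (norm_on K) (lift_series f) (lift_series g)"
proof -
  interpret f: star_hom f using ex by unfold_locales (simp add: short_exact_cstar_def)
  interpret g: star_hom g using ex by unfold_locales (simp add: short_exact_cstar_def)
  \<comment> \<open>At the right end the kernel is the whole space, so every coset contains
    0.\<close>
  have "quotient_norm (norm_on K) (coset (kernel_on summable_series (\<lambda>_::'c fps. (0 :: 'c fps))) x) = 0"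
    if x: "x \<in> summable_series" for x :: "'c fps"
    unfolding quotient_norm_def
  proof (rule antisym)
    let ?C = "coset (kernel_on summable_series (\<lambda>_::'c fps. (0 :: 'c fps))) x"
    have C: "?C \<subseteq> summable_series" using x by (auto simp: coset_def kernel_on_def summable_series_add)
    have nn: "0 \<le> norm_on K z" if "z \<in> ?C" for z using that C norm_on_nonneg[OF K] by blast
    have "- x \<in> summable_series" using x by (simp add: summable_series_def)
    then have 0: "0 \<in> ?C" by (force simp: coset_def kernel_on_def)
    have "bdd_below (norm_on K ` ?C)" using nn by (rule bdd_belowI2)
    from cINF_lower[OF this 0] show "(INF z\<in>?C. norm_on K z) \<le> 0"
      by (simp only: norm_on_0[OF K(1)])
    show "0 \<le> (INF z\<in>?C. norm_on K z)"
      by (rule cINF_greatest) (use 0 nn in blast)+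
  qed
  then have "normal_map_on summable_series (norm_on K) (norm_on K) (\<lambda>_::'c fps. (0 :: 'c fps))"
    by (simp add: normal_map_on_def norm_on_0[OF K(1)])
  moreover have "linear_contraction_on summable_series (norm_on K) {0} (norm_on K) (\<lambda>_::'c fps. (0 :: 'c fps))"
    by (simp add: linear_contraction_on_def linear_map_on_def norm_on_0[OF K(1)] norm_on_nonneg[OF K])
  moreover have "normal_map_on {0} (norm_on K) (norm_on K) (\<lambda>_::'a fps. (0 :: 'a fps))"
    by (simp add: normal_map_on_def quotient_norm_def coset_def kernel_on_def Collect_conv_if)
  moreover have "linear_contraction_on {0} (norm_on K) summable_series (norm_on K) (\<lambda>_::'a fps. (0 :: 'a fps))"
    by (simp add: linear_contraction_on_def linear_map_on_def summable_series_0)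
  ultimately show ?thesis
    unfolding normal_short_exact_on_def
    by (intro conjI short_exact_lift[OF ex] f.normal_lift[OF K] g.normal_lift[OF K])
      (simp_all add: linear_contraction_on_def f.lift_linear_map g.lift_linear_map
        f.norm_on_lift_le[OF K] g.norm_on_lift_le[OF K])
qed

theorem theorem4:
  fixes K :: "real set"
  assumes "K \<subseteq> {-1..1}"
    and "0 islimpt K"
  shows
    "pre_cstar_algebra (summable_series :: 'a::cstar_algebra fps set) (norm_on K) \<and>
     pre_cstar_algebra (summable_series :: 'b::cstar_algebra fps set) (norm_on K) \<and>
     pre_cstar_algebra (summable_series :: 'c::cstar_algebra fps set) (norm_on K) \<and>
     (\<forall>f :: 'a \<Rightarrow> 'b. star_hom_on UNIV UNIV f \<longrightarrow>
        star_hom_on summable_series summable_series (lift_series f)) \<and>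
     (\<forall>F \<in> (summable_series :: 'a fps set). lift_series (\<lambda>x. x) F = F) \<and>
     (\<forall>(f :: 'a \<Rightarrow> 'b) (g :: 'b \<Rightarrow> 'c). star_hom_on UNIV UNIV f \<longrightarrow> star_hom_on UNIV UNIV g \<longrightarrow>
        (\<forall>F \<in> summable_series. lift_series (g \<circ> f) F = lift_series g (lift_series f F))) \<and>
     (\<forall>(f :: 'a \<Rightarrow> 'b) (g :: 'b \<Rightarrow> 'c). short_exact_cstar f g \<longrightarrow>
        star_hom_on summable_series summable_series (lift_series f) \<and>
        star_hom_on summable_series summable_series (lift_series g) \<and>
        normal_short_exact_on summable_series (norm_on K) summable_series (norm_on K)
          summable_series (norm_on K) (lift_series f) (lift_series g))"
proof -
  have ne: "K \<noteq> {}" using assms(2) by auto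
  show ?thesis
  proof (intro conjI allI ballI impI pre_cstar_algebra_summable_series[OF assms])
    fix f :: "'a \<Rightarrow> 'b" and g :: "'b \<Rightarrow> 'c"
    assume ex: "short_exact_cstar f g"
    then show "star_hom_on summable_series summable_series (lift_series f)"
      "star_hom_on summable_series summable_series (lift_series g)"
      by (auto simp: short_exact_cstar_def intro: star_hom.lift_star_hom star_hom.intro)
    show "normal_short_exact_on summable_series (norm_on K) summable_series (norm_on K)
      summable_series (norm_on K) (lift_series f) (lift_series g)"
      by (rule normal_short_exact_lift[OF ne assms(1) ex])
  qed (auto simp: fps_eq_iff lift_series_def intro: star_hom.lift_star_hom star_hom.intro)
qed

end
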